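(* Let $k$ be a positive integer. Then $$\mathcal U^{(0),k}(\Omega)\subset H^1(\Omega),\qquad \mathcal U^{(1),k}(\Omega)\subset H(\mathrm{curl},\Omega),\qquad \mathcal U^{(2),k}(\Omega)\subset H(\mathrm{div},\Omega),\qquad \mathcal U^{(3),k}(\Omega)\subset L^2(\Omega).$$
   Context: Finite pyramid: $\Omega=\{(\xi,\eta,\zeta)\in\mathbb R^3:\xi,\eta,\zeta\ge0,\ \xi\le1-\zeta,\ \eta\le1-\zeta\}$. Infinite pyramid: $\Omega_\infty=\{(x,y,z): 0\le x,y\le1,\ z\ge0\}$ (together with a point $\infty$). Map: $\phi:\Omega_\infty\to\Omega$, $\phi(x,y,z)=\left(\frac{x}{1+z},\frac{y}{1+z},\frac{z}{1+z}\right)$, a diffeomorphism onto $\Omega$ minus its apex $(0,0,1)$. Pullbacks: 0-forms $\phi^*u=u\circ\phi$; 1-forms $\phi^*E=D\phi^T(E\circ\phi)$; 2-forms $\phi^*v=|D\phi|D\phi^{-1}(v\circ\phi)$; 3-forms $\phi^*q=|D\phi|(q\circ\phi)$, $|D\phi|$ being the Jacobian determinant; $(\phi^{-1})^*=(\phi^* )^{-1}$. $Q^{l,m,n}$: polynomials of degree at most $l,m,n$ in $x,y,z$; $Q^{l,m,n}_k=\{u/(1+z)^k:u\in Q^{l,m,n}\}$; $P^n_k[w,z]=\{u(w,z)/(1+z)^k:u$ polynomial of total degree $\le n\}$; $\tilde P^{k-1}_{k+1}[w,1+z]=\frac{1}{(1+z)^{k+1}}\mathrm{span}\{w^a(1+z)^{k-1-a}:0\le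 a\le k-1\}$. Polynomial spaces with a negative degree are $\{0\}$. Subscripts $x,y$ on $r,s,t$ denote partial derivatives. Spaces on $\Omega_\infty$ (the space on $\Omega$ is in each case $\mathcal U^{(s),k}(\Omega)=(\phi^{-1})^*\mathcal U^{(s),k}(\Omega_\infty)$, using the pullback of $s$-forms): $\mathcal U^{(0),k}(\Omega_\infty)$: all $u\in Q_k^{k,k,k-1}\oplus\mathrm{span}\{z^k/(1+z)^k\}$ whose restrictions to $y=0,1$ lie in $P_k^k[x,z]$ and to $x=0,1$ lie in $P_k^k[y,z]$. $\mathcal U^{(1),k}(\Omega_\infty)$: all $u\in Q_{k+1}^{k-1,k,k-1}\times Q_{k+1}^{k,k-1,k-1}\times Q_{k+1}^{k,k,k-2}\oplus\{\frac{z^{k-1}}{(1+z)^{k+1}}(r_xz,r_yz,-r)^T:r\in Q^{k,k}[x,y]\}$ such that on $y=0,1$ (with $w=x$) $(u_1,u_3)\in(P^{k-1}_{k+1}[w,z])^2\oplus\tilde P^{k-1}_{k+1}[w,1+z](1+z,-w)^T$, and on $x=0,1$ (with $w=y$) $(u_2,u_3)$ lies in the same space. $\mathcal U^{(2),k}(\Omega_\infty)$: all $u\in Q_{k+2}^{k,k-1,k-2}\times Q_{k+2}^{k-1,k,k-2}\times Q_{k+2}^{k-1,k-1,k-1}\oplus\{\frac{z^{k-1}}{(1+z)^{k+2}}(0,2s,s_y(1+z))^T:s\in Q^{k-1,k}[x,y]\}\oplus\{\frac{z^{k-1}}{(1+z)^{k+2}}(2t,0,t_x(1+z))^T:t\in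 Q^{k,k-1}[x,y]\}$ whose normal components lie in $P^{k-1}_{k+2}[x,z]$ on $y=0,1$ and in $P^{k-1}_{k+2}[y,z]$ on $x=0,1$. $\mathcal U^{(3),k}(\Omega_\infty)=Q_{k+3}^{k-1,k-1,k-1}$. *)

theory Defs
  imports "HOL-Analysis.Analysis"
begin

section \<open>Pyramids and pullbacks\<close>

definition pyramid :: "(real^3) set" where
  "pyramid = {p. p$1 \<ge> 0 \<and> p$2 \<ge> 0 \<and> p$3 \<ge> 0 \<and> p$1 \<le> 1 - p$3 \<and> p$2 \<le> 1 - p$3}"

text \<open>The point at infinity, which corresponds to the apex $(0,0,1)$ of the finite pyramid,
  is left out: no condition below involves a value there.\<close>

definition inf_pyramid :: "(real^3) set" where
  "inf_pyramid = {p. 0 \<le> p$1 \<and> p$1 \<le> 1 \<and> 0 \<le> p$2 \<and> p$2 \<le> 1 \<and> p$3 \<ge> 0}"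

definition pyr_map :: "real^3 \<Rightarrow> real^3" where
  "pyr_map p = vector [p$1 / (1 + p$3), p$2 / (1 + p$3), p$3 / (1 + p$3)]"

definition pullback0 :: "(real^3 \<Rightarrow> real^3) \<Rightarrow> (real^3 \<Rightarrow> real) \<Rightarrow> real^3 \<Rightarrow> real" where
  "pullback0 \<phi> u p = u (\<phi> p)"

definition pullback1 :: "(real^3 \<Rightarrow> real^3) \<Rightarrow> (real^3 \<Rightarrow> real^3) \<Rightarrow> real^3 \<Rightarrow> real^3" where
  "pullback1 \<phi> E p = transpose (jacobian \<phi> (at p)) *v E (\<phi> p)"

definition pullback2 :: "(real^3 \<Rightarrow> real^3) \<Rightarrow> (real^3 \<Rightarrow> real^3) \<Rightarrow> real^3 \<Rightarrow> real^3" where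
  "pullback2 \<phi> v p =
     det (jacobian \<phi> (at p)) *\<^sub>R (matrix_inv (jacobian \<phi> (at p)) *v v (\<phi> p))"

definition pullback3 :: "(real^3 \<Rightarrow> real^3) \<Rightarrow> (real^3 \<Rightarrow> real) \<Rightarrow> real^3 \<Rightarrow> real" where
  "pullback3 \<phi> q p = det (jacobian \<phi> (at p)) * q (\<phi> p)"


section \<open>Polynomial and rational spaces\<close>

text \<open>Degree bounds are integers; for a negative bound the index set of the sum is empty,
  so the space is the zero space.\<close>

definition Qpoly3 :: "int \<Rightarrow> int \<Rightarrow> int \<Rightarrow> (real \<Rightarrow> real \<Rightarrow> real \<Rightarrow> real) set" where
  "Qpoly3 l m n = {q. \<exists>c :: nat \<Rightarrow> nat \<Rightarrow> nat \<Rightarrow> real. q =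
     (\<lambda>x y z. \<Sum>a | int a \<le> l. \<Sum>b | int b \<le> m. \<Sum>d | int d \<le> n. c a b d * x^a * y^b * z^d)}"

definition Qpoly2 :: "int \<Rightarrow> int \<Rightarrow> (real \<Rightarrow> real \<Rightarrow> real) set" where
  "Qpoly2 l m = {q. \<exists>c :: nat \<Rightarrow> nat \<Rightarrow> real. q =
     (\<lambda>x y. \<Sum>a | int a \<le> l. \<Sum>b | int b \<le> m. c a b * x^a * y^b)}"

definition Ppoly2 :: "int \<Rightarrow> (real \<Rightarrow> real \<Rightarrow> real) set" where
  "Ppoly2 n = {q. \<exists>c :: nat \<Rightarrow> nat \<Rightarrow> real. q =
     (\<lambda>w z. \<Sum>(a, b) | int (a + b) \<le> n. c a b * w^a * z^b)}"

text \<open>Functions on the infinite pyramid, or on one of its vertical faces with coordinates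
  $w \in [0,1]$ and $z \ge 0$, are total functions considered only there: every space below is
  closed under changing a function outside its domain.\<close>

definition Qrat :: "nat \<Rightarrow> int \<Rightarrow> int \<Rightarrow> int \<Rightarrow> (real^3 \<Rightarrow> real) set" where
  "Qrat k l m n = {u. \<exists>q \<in> Qpoly3 l m n. \<forall>p \<in> inf_pyramid.
     u p = q (p$1) (p$2) (p$3) / (1 + p$3)^k}"

definition Prat :: "nat \<Rightarrow> int \<Rightarrow> (real \<Rightarrow> real \<Rightarrow> real) set" where
  "Prat k n = {f. \<exists>q \<in> Ppoly2 n. \<forall>w z. 0 \<le> w \<and> w \<le> 1 \<and> 0 \<le> z \<longrightarrow>
     f w z = q w z / (1 + z)^k}"

text \<open>\<open>Ptilde k\<close> is $\tilde P^{k-1}_{k+1}[w,1+z]$.\<close>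

definition Ptilde :: "nat \<Rightarrow> (real \<Rightarrow> real \<Rightarrow> real) set" where
  "Ptilde k = {f. \<exists>c :: nat \<Rightarrow> real. \<forall>w z. 0 \<le> w \<and> w \<le> 1 \<and> 0 \<le> z \<longrightarrow>
     f w z = (\<Sum>a<k. c a * w^a * (1 + z)^(k - 1 - a)) / (1 + z)^(k + 1)}"

text \<open>\<open>face_curl k\<close> is the space $(P^{k-1}_{k+1}[w,z])^2 \oplus
  \tilde P^{k-1}_{k+1}[w,1+z]\,(1+z,-w)^T$ of tangential traces on a vertical face.\<close>

definition face_curl :: "nat \<Rightarrow> ((real \<Rightarrow> real \<Rightarrow> real) \<times> (real \<Rightarrow> real \<Rightarrow> real)) set" where
  "face_curl k = {(f, g). \<exists>f0 \<in> Prat (k + 1) (int k - 1). \<exists>g0 \<in> Prat (k + 1) (int k - 1).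
     \<exists>h \<in> Ptilde k. \<forall>w z. 0 \<le> w \<and> w \<le> 1 \<and> 0 \<le> z \<longrightarrow>
       f w z = f0 w z + h w z * (1 + z) \<and> g w z = g0 w z - h w z * w}"


section \<open>The approximation spaces\<close>

definition U0_inf :: "nat \<Rightarrow> (real^3 \<Rightarrow> real) set" where
  "U0_inf k = {u.
     (\<exists>q \<in> Qrat k (int k) (int k) (int k - 1). \<exists>a :: real. \<forall>p \<in> inf_pyramid.
        u p = q p + a * ((p$3)^k / (1 + p$3)^k)) \<and>
     (\<forall>e \<in> {0, 1}. (\<lambda>w z. u (vector [w, e, z])) \<in> Prat k (int k) \<and>
                   (\<lambda>w z. u (vector [e, w, z])) \<in> Prat k (int k))}"

definition U1_inf :: "nat \<Rightarrow> (real^3 \<Rightarrow> real^3) set" where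
  "U1_inf k = {u.
     (\<exists>q1 \<in> Qrat (k + 1) (int k - 1) (int k) (int k - 1).
      \<exists>q2 \<in> Qrat (k + 1) (int k) (int k - 1) (int k - 1).
      \<exists>q3 \<in> Qrat (k + 1) (int k) (int k) (int k - 2).
      \<exists>r \<in> Qpoly2 (int k) (int k).
      \<forall>p \<in> inf_pyramid. let x = p$1; y = p$2; z = p$3 in
        u p = vector [q1 p, q2 p, q3 p] + (z^(k - 1) / (1 + z)^(k + 1)) *\<^sub>R
                vector [deriv (\<lambda>t. r t y) x * z, deriv (\<lambda>t. r x t) y * z, - r x y]) \<and>
     (\<forall>e \<in> {0, 1}.
        ((\<lambda>w z. u (vector [w, e, z]) $ 1), (\<lambda>w z. u (vector [w, e, z]) $ 3)) \<in> face_curl k \<and>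
        ((\<lambda>w z. u (vector [e, w, z]) $ 2), (\<lambda>w z. u (vector [e, w, z]) $ 3)) \<in> face_curl k)}"

definition U2_inf :: "nat \<Rightarrow> (real^3 \<Rightarrow> real^3) set" where
  "U2_inf k = {u.
     (\<exists>q1 \<in> Qrat (k + 2) (int k) (int k - 1) (int k - 2).
      \<exists>q2 \<in> Qrat (k + 2) (int k - 1) (int k) (int k - 2).
      \<exists>q3 \<in> Qrat (k + 2) (int k - 1) (int k - 1) (int k - 1).
      \<exists>s \<in> Qpoly2 (int k - 1) (int k).
      \<exists>t \<in> Qpoly2 (int k) (int k - 1).
      \<forall>p \<in> inf_pyramid. let x = p$1; y = p$2; z = p$3 in
        u p = vector [q1 p, q2 p, q3 p]
            + (z^(k - 1) / (1 + z)^(k + 2)) *\<^sub>R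
                vector [0, 2 * s x y, deriv (\<lambda>v. s x v) y * (1 + z)]
            + (z^(k - 1) / (1 + z)^(k + 2)) *\<^sub>R
                vector [2 * t x y, 0, deriv (\<lambda>v. t v y) x * (1 + z)]) \<and>
     (\<forall>e \<in> {0, 1}.
        (\<lambda>w z. u (vector [w, e, z]) $ 2) \<in> Prat (k + 2) (int k - 1) \<and>
        (\<lambda>w z. u (vector [e, w, z]) $ 1) \<in> Prat (k + 2) (int k - 1))}"

definition U3_inf :: "nat \<Rightarrow> (real^3 \<Rightarrow> real) set" where
  "U3_inf k = Qrat (k + 3) (int k - 1) (int k - 1) (int k - 1)"

text \<open>The spaces on the finite pyramid are the images under
  $(\phi^{-1})^* = (\phi^*)^{-1}$, that is, the preimages under $\phi^*$.  Only the values on the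
  pyramid without its apex matter; those are determined by the pullback.\<close>

definition U0 :: "nat \<Rightarrow> (real^3 \<Rightarrow> real) set" where
  "U0 k = {u. pullback0 pyr_map u \<in> U0_inf k}"

definition U1 :: "nat \<Rightarrow> (real^3 \<Rightarrow> real^3) set" where
  "U1 k = {u. pullback1 pyr_map u \<in> U1_inf k}"

definition U2 :: "nat \<Rightarrow> (real^3 \<Rightarrow> real^3) set" where
  "U2 k = {u. pullback2 pyr_map u \<in> U2_inf k}"

definition U3 :: "nat \<Rightarrow> (real^3 \<Rightarrow> real) set" where
  "U3 k = {u. pullback3 pyr_map u \<in> U3_inf k}"


section \<open>Sobolev spaces\<close>

definition partial :: "'n::finite \<Rightarrow> (real^'n \<Rightarrow> real) \<Rightarrow> real^'n \<Rightarrow> real" where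
  "partial i f x = frechet_derivative f (at x) (axis i 1)"

definition grad :: "(real^'n::finite \<Rightarrow> real) \<Rightarrow> real^'n \<Rightarrow> real^'n" where
  "grad f x = (\<chi> i. partial i f x)"

definition curl :: "(real^3 \<Rightarrow> real^3) \<Rightarrow> real^3 \<Rightarrow> real^3" where
  "curl f x = vector
     [partial 2 (\<lambda>y. f y $ 3) x - partial 3 (\<lambda>y. f y $ 2) x,
      partial 3 (\<lambda>y. f y $ 1) x - partial 1 (\<lambda>y. f y $ 3) x,
      partial 1 (\<lambda>y. f y $ 2) x - partial 2 (\<lambda>y. f y $ 1) x]"

primrec Ck_fun :: "nat \<Rightarrow> (real^'n::finite \<Rightarrow> real) \<Rightarrow> bool" where
  "Ck_fun 0 f \<longleftrightarrow> continuous_on UNIV f"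
| "Ck_fun (Suc n) f \<longleftrightarrow> (\<forall>x. f differentiable (at x)) \<and> (\<forall>i. Ck_fun n (partial i f))"

text \<open>Sobolev spaces over a set \<open>D\<close> are those of its interior; for the pyramid, the boundary
  is a null set.  Elements are functions instead of classes modulo null sets.\<close>

definition test_funs :: "(real^'n::finite) set \<Rightarrow> (real^'n \<Rightarrow> real) set" where
  "test_funs D = {\<phi>. (\<forall>n. Ck_fun n \<phi>) \<and> compact (closure {x. \<phi> x \<noteq> 0}) \<and>
     closure {x. \<phi> x \<noteq> 0} \<subseteq> interior D}"

definition L2_space :: "(real^'n::finite) set \<Rightarrow> (real^'n \<Rightarrow> 'b::euclidean_space) set" where
  "L2_space D = {u. set_borel_measurable lebesgue D u \<and>
     set_integrable lebesgue D (\<lambda>x. (norm (u x))\<^sup>2)}"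

definition H1_space :: "(real^'n::finite) set \<Rightarrow> (real^'n \<Rightarrow> real) set" where
  "H1_space D = {u \<in> L2_space D. \<exists>g \<in> L2_space D. \<forall>\<phi> \<in> test_funs D. \<forall>i.
     (LINT x:D|lebesgue. u x * partial i \<phi> x) = - (LINT x:D|lebesgue. (g x $ i) * \<phi> x)}"

definition Hcurl_space :: "(real^3) set \<Rightarrow> (real^3 \<Rightarrow> real^3) set" where
  "Hcurl_space D = {u \<in> L2_space D. \<exists>c \<in> L2_space D.
     \<forall>\<psi>. (\<forall>i. (\<lambda>x. \<psi> x $ i) \<in> test_funs D) \<longrightarrow>
       (LINT x:D|lebesgue. u x \<bullet> curl \<psi> x) = (LINT x:D|lebesgue. c x \<bullet> \<psi> x)}"

definition Hdiv_space :: "(real^'n::finite) set \<Rightarrow> (real^'n \<Rightarrow> real^'n) set" where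
  "Hdiv_space D = {u \<in> L2_space D. \<exists>d \<in> L2_space D. \<forall>\<phi> \<in> test_funs D.
     (LINT x:D|lebesgue. u x \<bullet> grad \<phi> x) = - (LINT x:D|lebesgue. d x * \<phi> x)}"

end

theory Submission
  imports Defs
begin

text \<open>In the coordinates \<open>x = \<xi> / w\<close>, \<open>y = \<eta> / w\<close>, \<open>w = 1 - \<zeta>\<close> of the finite pyramid, every
  element of the four spaces is a polynomial in \<open>(x, y, w)\<close>, hence bounded, and smooth away from the
  apex. A function \<open>w Q(x, y, w)\<close> has a gradient that is again polynomial in \<open>(x, y, w)\<close>; this covers
  the full polynomial parts of the spaces. For the extra terms only the curl or the divergence is
  bounded: their contributions of order \<open>1 / w\<close> cancel. Since test functions vanish near the apex,
  the classical derivatives are the weak ones.\<close>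

section \<open>Weak derivatives of functions that are continuously differentiable in the interior\<close>

text \<open>Powers of \<open>w\<close> have to be counted. The gradients of \<open>x\<close> and
  \<open>y\<close> are of order \<open>1 / w\<close>, so a function of \<open>(x, y, w)\<close>
  needs one spare factor \<open>w\<close> to have a bounded gradient. Since
  \<open>z = (1 - w) / w\<close> and \<open>1 + z = 1 / w\<close>, a denominator
  \<open>(1 + z)^K\<close> with degree at most \<open>n\<close> in \<open>z\<close> supplies
  \<open>K - n\<close> factors. Inverting the pullback consumes none for 0-forms, 1, 1, 2 for the
  components of 1-forms, 3, 3, 2 for those of 2-forms, and 4 for 3-forms. The degrees in the
  definitions thus leave exactly one factor for the full polynomial parts of 0-, 1- and 2-forms, and
  none for 3-forms, where boundedness is enough. The extra terms are left with no spare factor. For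
  0-forms this does no harm, the term being \<zeta>^k, a polynomial in the Cartesian coordinates;
  for 1- and 2-forms the relation between the components has to compensate.\<close>

text \<open>The derivative is represented by a vector through the inner product, over any Euclidean
  space, so that one calculus serves both \<open>real^3\<close> and the coordinate triples
  \<open>(x, y, w)\<close>.\<close>

definition grad_on :: "'a::euclidean_space set \<Rightarrow> ('a \<Rightarrow> real) \<Rightarrow> ('a \<Rightarrow> 'a) \<Rightarrow> bool" where
  "grad_on S f g \<longleftrightarrow> continuous_on S g \<and> (\<forall>x\<in>S. (f has_derivative (\<lambda>h. g x \<bullet> h)) (at x))"

lemma grad_on_has_derivative:
  "grad_on S f g \<Longrightarrow> x \<in> S \<Longrightarrow> (f has_derivative (\<lambda>h. g x \<bullet> h)) (at x)"
  by (simp add: grad_on_def)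

lemma grad_on_imp_continuous_grad: "grad_on S f g \<Longrightarrow> continuous_on S g"
  by (simp add: grad_on_def)

lemma grad_on_imp_continuous: "grad_on S f g \<Longrightarrow> continuous_on S f"
  by (meson grad_on_has_derivative has_derivative_continuous continuous_at_imp_continuous_on)

lemma grad_on_subset: "grad_on S f g \<Longrightarrow> T \<subseteq> S \<Longrightarrow> grad_on T f g"
  unfolding grad_on_def using continuous_on_subset by blast

lemma grad_on_cong:
  assumes "grad_on S f g" "open S" "\<And>x. x \<in> S \<Longrightarrow> f x = f' x" "\<And>x. x \<in> S \<Longrightarrow> g x = g' x"
  shows "grad_on S f' g'"
  unfolding grad_on_def
proof (intro conjI ballI)
  show "continuous_on S g'"
    using assms(1,4) by (metis continuous_on_cong grad_on_imp_continuous_grad)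
  fix x assume x: "x \<in> S"
  have "(f has_derivative (\<lambda>h. g' x \<bullet> h)) (at x)"
    using grad_on_has_derivative[OF assms(1) x] assms(4)[OF x] by simp
  then show "(f' has_derivative (\<lambda>h. g' x \<bullet> h)) (at x)"
    by (rule has_derivative_transform_within_open[OF _ assms(2) x]) (use assms(3) in auto)
qed

lemma grad_on_const: "grad_on S (\<lambda>x. c) (\<lambda>x. 0)"
  by (auto simp: grad_on_def)

lemma grad_on_inner: "grad_on S (\<lambda>x. a \<bullet> x) (\<lambda>x. a)"
  by (auto simp: grad_on_def intro!: derivative_eq_intros)

lemma grad_on_add:
  "grad_on S f g \<Longrightarrow> grad_on S f' g' \<Longrightarrow> grad_on S (\<lambda>x. f x + f' x) (\<lambda>x. g x + g' x)"
  by (auto simp: grad_on_def inner_add_left intro!: continuous_intros has_derivative_add)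

lemma grad_on_diff:
  "grad_on S f g \<Longrightarrow> grad_on S f' g' \<Longrightarrow> grad_on S (\<lambda>x. f x - f' x) (\<lambda>x. g x - g' x)"
  by (auto simp: grad_on_def inner_diff_left intro!: continuous_intros has_derivative_diff)

lemma grad_on_minus: "grad_on S f g \<Longrightarrow> grad_on S (\<lambda>x. - f x) (\<lambda>x. - g x)"
  by (auto simp: grad_on_def intro!: continuous_intros has_derivative_minus)

lemma grad_on_mult:
  assumes "grad_on S f g" "grad_on S f' g'"
  shows "grad_on S (\<lambda>x. f x * f' x) (\<lambda>x. f x *\<^sub>R g' x + f' x *\<^sub>R g x)"
  unfolding grad_on_def
proof (intro conjI ballI)
  show "continuous_on S (\<lambda>x. f x *\<^sub>R g' x + f' x *\<^sub>R g x)"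
    by (intro continuous_intros grad_on_imp_continuous grad_on_imp_continuous_grad)
       (use assms in auto)
  show "((\<lambda>x. f x * f' x) has_derivative (\<lambda>h. (f x *\<^sub>R g' x + f' x *\<^sub>R g x) \<bullet> h)) (at x)"
    if "x \<in> S" for x
    using has_derivative_mult[OF grad_on_has_derivative[OF assms(1) that]
        grad_on_has_derivative[OF assms(2) that]]
    by (simp add: inner_add_left algebra_simps)
qed

lemma grad_on_power:
  assumes "grad_on S f g"
  shows "grad_on S (\<lambda>x. f x ^ n) (\<lambda>x. (real n * f x ^ (n - 1)) *\<^sub>R g x)"
  unfolding grad_on_def
proof (intro conjI ballI)
  show "continuous_on S (\<lambda>x. (real n * f x ^ (n - 1)) *\<^sub>R g x)"
    by (intro continuous_intros grad_on_imp_continuous grad_on_imp_continuous_grad)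
       (use assms in auto)
  show "((\<lambda>x. f x ^ n) has_derivative (\<lambda>h. (real n * f x ^ (n - 1)) *\<^sub>R g x \<bullet> h)) (at x)"
    if "x \<in> S" for x
    using has_derivative_power[OF grad_on_has_derivative[OF assms(1) that], of n]
    by (simp add: algebra_simps)
qed

lemma grad_on_inverse:
  assumes "grad_on S f g" "\<And>x. x \<in> S \<Longrightarrow> f x \<noteq> 0"
  shows "grad_on S (\<lambda>x. inverse (f x)) (\<lambda>x. (- (inverse (f x))\<^sup>2) *\<^sub>R g x)"
  unfolding grad_on_def
proof (intro conjI ballI)
  show "continuous_on S (\<lambda>x. (- (inverse (f x))\<^sup>2) *\<^sub>R g x)"
    by (intro continuous_intros grad_on_imp_continuous grad_on_imp_continuous_grad)
       (use assms in auto)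
  show "((\<lambda>x. inverse (f x)) has_derivative (\<lambda>h. (- (inverse (f x))\<^sup>2) *\<^sub>R g x \<bullet> h)) (at x)"
    if "x \<in> S" for x
    using Deriv.has_derivative_inverse[OF assms(2)[OF that] grad_on_has_derivative[OF assms(1) that]]
    by (simp add: algebra_simps power2_eq_square)
qed

text \<open>Translation invariance makes the difference quotients integrate to zero, and the
  compact support allows dominated convergence; this avoids Fubini.\<close>

lemma integral_directional_derivative_eq_0:
  fixes F :: "'a::euclidean_space \<Rightarrow> real"
  assumes F: "grad_on UNIV F G" and K: "compact K" and F0: "\<And>x. x \<notin> K \<Longrightarrow> F x = 0"
  shows "(LINT x|lborel. G x \<bullet> e) = 0"
proof -
  have der: "(F has_derivative (\<lambda>h. G x \<bullet> h)) (at x)" for x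
    using F by (simp add: grad_on_def)
  have contG: "continuous_on UNIV G" and contF: "continuous_on UNIV F"
    using F by (auto intro: grad_on_imp_continuous grad_on_imp_continuous_grad)
  have G0: "G x = 0" if "x \<notin> K" for x
  proof -
    have "((\<lambda>x. 0) has_derivative (\<lambda>h. G x \<bullet> h)) (at x)"
      by (rule has_derivative_transform_within_open[OF der[of x], of "- K"])
         (use that K F0 in \<open>auto simp: compact_imp_closed open_Compl\<close>)
    \<comment> \<open>The vanishing derivative is evaluated in the direction \<open>G x\<close>
      itself.\<close>
    from has_derivative_unique[OF this has_derivative_const[of 0]]
    have "G x \<bullet> G x = 0" by metis
    then show ?thesis by simp
  qed
  have "bounded (G ` K)"
    using compact_continuous_image[OF continuous_on_subset[OF contG] K] compact_imp_bounded by blast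
  then obtain B where B: "\<And>x. x \<in> K \<Longrightarrow> norm (G x) \<le> B" and "B > 0"
    unfolding bounded_pos by blast
  then have GB: "norm (G x) \<le> B" for x
    by (cases "x \<in> K") (auto simp: G0)
  have lip: "norm (F y - F x) \<le> B * norm (y - x)" for x y
  proof (rule differentiable_bound[of UNIV])
    show "onorm (\<lambda>h. G x \<bullet> h) \<le> B" for x
    proof (rule onorm_le)
      fix h
      have "\<bar>G x \<bullet> h\<bar> \<le> norm (G x) * norm h" by (rule Cauchy_Schwarz_ineq2)
      also have "\<dots> \<le> B * norm h" using GB by (simp add: mult_right_mono)
      finally show "norm (G x \<bullet> h) \<le> B * norm h" by simp
    qed
  qed (use der in auto)
  define s where "s n x = (F (x + (1 / real (Suc n)) *\<^sub>R e) - F x) * real (Suc n)" for n x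
  obtain R where R: "\<And>x. x \<in> K \<Longrightarrow> norm x \<le> R"
    using compact_imp_bounded[OF K] unfolding bounded_iff by blast
  \<comment> \<open>Dominating function: \<open>s n\<close> is bounded by the Lipschitz constant
    times \<open>norm e\<close>, and its shifts have length at most \<open>norm e\<close>, so it
    vanishes outside the ball of radius \<open>R + norm e\<close>.\<close>
  define w where "w x = indicator (cball 0 (R + norm e)) x *\<^sub>R (B * norm e)" for x :: 'a
  have intF: "integrable lborel F"
  proof -
    have "integrable lborel (\<lambda>x. indicator K x *\<^sub>R F x)"
      by (rule borel_integrable_compact[OF K]) (use contF continuous_on_subset in blast)
    also have "(\<lambda>x. indicator K x *\<^sub>R F x) = F"
      using F0 by (auto simp: indicator_def fun_eq_iff)
    finally show ?thesis .
  qed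
  have meas[measurable]: "F \<in> borel_measurable borel"
    using contF by (rule borel_measurable_continuous_onI)
  have tr: "integrable lborel (\<lambda>x. F (x + c))" "(LINT x|lborel. F (x + c)) = (LINT x|lborel. F x)" for c
  proof -
    have "integrable (distr lborel borel ((+) c)) F" using intF by (simp add: lborel_distr_plus)
    then show "integrable lborel (\<lambda>x. F (x + c))"
      by (subst (asm) integrable_distr_eq) (auto simp: add.commute)
    have "(LINT x|lborel. F x) = (LINT x|distr lborel borel ((+) c). F x)"
      by (simp add: lborel_distr_plus)
    also have "\<dots> = (LINT x|lborel. F (x + c))"
      by (subst integral_distr) (auto simp: add.commute)
    finally show "(LINT x|lborel. F (x + c)) = (LINT x|lborel. F x)" by simp
  qed
  have s0: "(LINT x|lborel. s n x) = 0" for n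
    unfolding s_def using tr intF by simp
  have "(\<lambda>n. LINT x|lborel. s n x) \<longlonglongrightarrow> (LINT x|lborel. G x \<bullet> e)"
  proof (rule integral_dominated_convergence[where w = w])
    show "(\<lambda>x. G x \<bullet> e) \<in> borel_measurable lborel"
      using borel_measurable_continuous_onI[of "\<lambda>x. G x \<bullet> e"] contG
      by (simp add: continuous_on_inner)
    show "s n \<in> borel_measurable lborel" for n unfolding s_def by measurable
    show "integrable lborel w"
      unfolding w_def by (rule borel_integrable_compact) auto
    show "AE x in lborel. (\<lambda>n. s n x) \<longlonglongrightarrow> G x \<bullet> e"
    proof (rule AE_I2)
      fix x
      have "((\<lambda>t. F (x + t *\<^sub>R e)) has_derivative (\<lambda>t. G x \<bullet> (t *\<^sub>R e))) (at 0)"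
        by (rule has_derivative_compose[of "\<lambda>t. x + t *\<^sub>R e" "\<lambda>t. t *\<^sub>R e" 0 UNIV F "\<lambda>h. G x \<bullet> h"])
           (auto intro!: derivative_eq_intros der)
      then have "((\<lambda>t. F (x + t *\<^sub>R e)) has_field_derivative (G x \<bullet> e)) (at 0)"
        by (simp add: has_field_derivative_def mult.commute[of _ "G x \<bullet> e"])
      then have "((\<lambda>t. (F (x + t *\<^sub>R e) - F x) / t) \<longlongrightarrow> G x \<bullet> e) (at 0)"
        by (simp add: DERIV_def)
      moreover have "filterlim (\<lambda>n. 1 / real (Suc n)) (at 0) sequentially"
        unfolding filterlim_at using LIMSEQ_inverse_real_of_nat by (simp add: inverse_eq_divide)
      ultimately have "((\<lambda>n. (F (x + (1 / real (Suc n)) *\<^sub>R e) - F x) / (1 / real (Suc n))) \<longlongrightarrow> G x \<bullet> e) sequentially"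
        by (rule filterlim_compose)
      then show "(\<lambda>n. s n x) \<longlonglongrightarrow> G x \<bullet> e" by (simp add: s_def)
    qed
    show "AE x in lborel. norm (s n x) \<le> w x" for n
    proof (rule AE_I2)
      fix x
      show "norm (s n x) \<le> w x"
      proof (cases "norm x \<le> R + norm e")
        case True
        have "norm (s n x) = norm (F (x + (1 / real (Suc n)) *\<^sub>R e) - F x) * real (Suc n)"
          by (simp add: s_def abs_mult del: of_nat_Suc)
        also have "\<dots> \<le> (B * norm (x + (1 / real (Suc n)) *\<^sub>R e - x)) * real (Suc n)"
          by (rule mult_right_mono[OF lip]) simp
        also have "\<dots> = B * norm e" by simp
        finally show ?thesis using True by (simp add: w_def)
      next
        case False
        have "F x = 0" using False R[of x] F0[of x] by (smt (verit) norm_ge_zero)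
        moreover have "F (x + (1 / real (Suc n)) *\<^sub>R e) = 0"
        proof (rule F0, rule notI)
          assume "x + (1 / real (Suc n)) *\<^sub>R e \<in> K"
          then have "norm (x + (1 / real (Suc n)) *\<^sub>R e) \<le> R" by (rule R)
          moreover have "norm ((1 / real (Suc n)) *\<^sub>R e) \<le> norm e"
            by (simp add: divide_le_eq mult_le_cancel_left1)
          moreover have "norm x \<le> norm (x + (1 / real (Suc n)) *\<^sub>R e) + norm ((1 / real (Suc n)) *\<^sub>R e)"
            by (metis add_diff_cancel norm_triangle_ineq4)
          ultimately show False using False by linarith
        qed
        ultimately show ?thesis using False by (simp add: s_def w_def)
      qed
    qed
  qed
  then have "(\<lambda>n. 0::real) \<longlonglongrightarrow> (LINT x|lborel. G x \<bullet> e)" using s0 by simp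
  then show ?thesis using LIMSEQ_unique tendsto_const by blast
qed

section \<open>Test functions and integration by parts\<close>

lemma test_funsE:
  fixes \<phi> :: "real^'n::finite \<Rightarrow> real"
  assumes "\<phi> \<in> test_funs D"
  obtains K where "compact K" "K \<subseteq> interior D" "grad_on UNIV \<phi> (grad \<phi>)"
    "\<And>x. x \<notin> K \<Longrightarrow> \<phi> x = 0" "\<And>x. x \<notin> K \<Longrightarrow> grad \<phi> x = 0"
proof -
  define K where "K = closure {x. \<phi> x \<noteq> 0}"
  \<comment> \<open>This level of smoothness contains Frechet differentiability as well as
    continuity of the partial derivatives.\<close>
  have "Ck_fun (Suc 0) \<phi>" using assms by (simp add: test_funs_def)
  then have d: "\<And>x. \<phi> differentiable (at x)" and c: "\<And>i. continuous_on UNIV (partial i \<phi>)"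
    by auto
  have K: "compact K" "K \<subseteq> interior D"
    using assms by (auto simp: test_funs_def K_def)
  have \<phi>0: "\<phi> x = 0" if "x \<notin> K" for x
    using that closure_subset[of "{x. \<phi> x \<noteq> 0}"] by (auto simp: K_def)
  have der: "(\<phi> has_derivative (\<lambda>h. grad \<phi> x \<bullet> h)) (at x)" for x
  proof -
    have D: "(\<phi> has_derivative frechet_derivative \<phi> (at x)) (at x)"
      using d frechet_derivative_works by blast
    then interpret linear "frechet_derivative \<phi> (at x)" by (rule has_derivative_linear)
    have "frechet_derivative \<phi> (at x) h = grad \<phi> x \<bullet> h" for h
    proof -
      have "frechet_derivative \<phi> (at x) h = frechet_derivative \<phi> (at x) (\<Sum>i\<in>UNIV. (h $ i) *\<^sub>R axis i 1)"
        by (simp add: basis_expansion flip: scalar_mult_eq_scaleR)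
      also have "\<dots> = (\<Sum>i\<in>UNIV. h $ i * partial i \<phi> x)"
        by (simp add: sum scale partial_def)
      finally show ?thesis by (simp add: inner_vec_def grad_def mult.commute)
    qed
    then have "frechet_derivative \<phi> (at x) = (\<lambda>h. grad \<phi> x \<bullet> h)" by auto
    with D show ?thesis by simp
  qed
  have grad: "grad_on UNIV \<phi> (grad \<phi>)"
    unfolding grad_on_def using der c
    by (auto simp: grad_def continuous_on_vec_lambda)
  have "grad \<phi> x = 0" if "x \<notin> K" for x
  proof -
    have "((\<lambda>x. 0) has_derivative (\<lambda>h. grad \<phi> x \<bullet> h)) (at x)"
      by (rule has_derivative_transform_within_open[OF der[of x], of "- K"])
         (use that \<phi>0 K in \<open>auto simp: compact_imp_closed open_Compl\<close>)
    from has_derivative_unique[OF this has_derivative_const[of 0]]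
    have "grad \<phi> x \<bullet> grad \<phi> x = 0" by metis
    then show "grad \<phi> x = 0" by simp
  qed
  with K grad \<phi>0 show ?thesis by (rule that)
qed

text \<open>The integrand cut off to \<open>D\<close> is \<open>f\<close> itself, which is Borel
  measurable; hence the restriction to \<open>D\<close> and the completion of the measure both
  disappear.\<close>

lemma integrable_zero_extension:
  fixes f :: "real^'n::finite \<Rightarrow> real"
  assumes "continuous_on UNIV f" "compact K" "K \<subseteq> D" "\<And>x. x \<notin> K \<Longrightarrow> f x = 0"
    and "\<And>x. x \<in> D \<Longrightarrow> h x = f x"
  shows "set_integrable lebesgue D h" "(LINT x:D|lebesgue. h x) = (LINT x|lborel. f x)"
proof -
  have eq: "(\<lambda>x. indicator D x *\<^sub>R h x) = f"
    using assms(3,4,5) by (fastforce simp: indicator_def fun_eq_iff)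
  have eq': "(\<lambda>x. indicator K x *\<^sub>R f x) = f" using assms(4) by (auto simp: indicator_def fun_eq_iff)
  have "integrable lborel f"
    using borel_integrable_compact[OF assms(2), of f] continuous_on_subset[OF assms(1)] eq' by simp
  then show "set_integrable lebesgue D h"
    unfolding set_integrable_def eq
    by (subst integrable_completion) (use assms(1) in \<open>auto intro: borel_measurable_continuous_onI\<close>)
  show "(LINT x:D|lebesgue. h x) = (LINT x|lborel. f x)"
    using assms(1)
    unfolding set_lebesgue_integral_def eq
    by (subst integral_completion) (auto intro: borel_measurable_continuous_onI)
qed

text \<open>The open sets \<open>U\<close> and \<open>- K\<close> cover the space; on the second the
  function is zero. The factor \<open>f\<close> may be unbounded near the boundary of
  \<open>U\<close>.\<close>

lemma zero_extension_continuous: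
  fixes f \<psi> :: "'a::euclidean_space \<Rightarrow> real"
  assumes "open U" "compact K" "K \<subseteq> U" "continuous_on U f" "continuous_on UNIV \<psi>"
    "\<And>x. x \<notin> K \<Longrightarrow> \<psi> x = 0"
  shows "continuous_on UNIV (\<lambda>x. if x \<in> U then f x * \<psi> x else 0)" (is "continuous_on _ ?F")
proof -
  have "continuous_on U ?F"
    using assms(4) continuous_on_subset[OF assms(5)]
    by (subst continuous_on_cong[OF refl, of U ?F "\<lambda>x. f x * \<psi> x"]) (auto intro!: continuous_intros)
  moreover have "continuous_on (- K) ?F"
    by (subst continuous_on_cong[OF refl, of "- K" ?F "\<lambda>x. 0"]) (use assms in auto)
  ultimately have "continuous_on (U \<union> - K) ?F"
    by (intro continuous_on_open_Un) (use assms in \<open>auto simp: compact_imp_closed open_Compl\<close>)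
  moreover have "U \<union> - K = UNIV" using assms by auto
  ultimately show ?thesis by simp
qed

text \<open>The compact support makes each product integrable even if \<open>f\<close> is not
  integrable over \<open>D\<close>. This permits splitting integrals of sums into separate
  terms.\<close>

lemma set_integrable_mult_test_fun:
  fixes \<phi> :: "real^'n::finite \<Rightarrow> real"
  assumes "continuous_on (interior D) f" "\<phi> \<in> test_funs D"
  shows "set_integrable lebesgue D (\<lambda>x. f x * \<phi> x)"
    and "set_integrable lebesgue D (\<lambda>x. f x * grad \<phi> x $ i)"
proof -
  obtain K where K: "compact K" "K \<subseteq> interior D" and grad: "grad_on UNIV \<phi> (grad \<phi>)"
    and \<phi>0: "\<And>x. x \<notin> K \<Longrightarrow> \<phi> x = 0" "\<And>x. x \<notin> K \<Longrightarrow> grad \<phi> x = 0"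
    using test_funsE[OF assms(2)] by blast
  have D: "K \<subseteq> D" using K(2) interior_subset by blast
  note ext = integrable_zero_extension(1)[OF zero_extension_continuous[OF open_interior K assms(1)] K(1) D]
  show "set_integrable lebesgue D (\<lambda>x. f x * \<phi> x)"
    by (rule ext[of \<phi>]) (use \<phi>0 K(2) in \<open>auto intro: grad_on_imp_continuous[OF grad]\<close>)
  show "set_integrable lebesgue D (\<lambda>x. f x * grad \<phi> x $ i)"
  proof (rule ext[of "\<lambda>x. grad \<phi> x $ i"])
    show "f x * grad \<phi> x $ i = (if x \<in> interior D then f x * grad \<phi> x $ i else 0)" for x
      using \<phi>0 K(2) by (cases "x \<in> K") auto
  qed (use \<phi>0 in \<open>auto intro!: continuous_intros grad_on_imp_continuous_grad[OF grad]\<close>)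
qed

text \<open>The product of \<open>f\<close> with the test function, extended by zero, is
  continuously differentiable on the whole space, so its partial derivative integrates to zero; the
  product rule yields the two sides.\<close>

lemma integral_by_parts_test_fun:
  fixes \<phi> :: "real^'n::finite \<Rightarrow> real"
  assumes f: "grad_on (interior D) f g" and \<phi>: "\<phi> \<in> test_funs D"
  shows "(LINT x:D|lebesgue. f x * grad \<phi> x $ i) = - (LINT x:D|lebesgue. g x $ i * \<phi> x)"
proof -
  let ?U = "interior D"
  obtain K where K: "compact K" "K \<subseteq> ?U" and grad: "grad_on UNIV \<phi> (grad \<phi>)"
    and \<phi>0: "\<And>x. x \<notin> K \<Longrightarrow> \<phi> x = 0" "\<And>x. x \<notin> K \<Longrightarrow> grad \<phi> x = 0"
    using test_funsE[OF \<phi>] by blast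
  have D: "K \<subseteq> D" using K(2) interior_subset by blast
  have cf: "continuous_on ?U f" and cg: "continuous_on ?U g"
    using f by (auto intro: grad_on_imp_continuous grad_on_imp_continuous_grad)
  let ?F = "\<lambda>x. if x \<in> ?U then f x * \<phi> x else 0"
  let ?G = "\<lambda>x. if x \<in> ?U then f x *\<^sub>R grad \<phi> x + \<phi> x *\<^sub>R g x else 0"
  have prod: "grad_on ?U (\<lambda>x. f x * \<phi> x) (\<lambda>x. f x *\<^sub>R grad \<phi> x + \<phi> x *\<^sub>R g x)"
    using f grad_on_subset[OF grad] by (intro grad_on_mult) auto
  have U: "grad_on ?U ?F ?G"
    by (rule grad_on_cong[OF prod]) auto
  have N: "grad_on (- K) ?F ?G"
    by (rule grad_on_cong[OF grad_on_const[of _ 0]])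
       (use \<phi>0 K in \<open>auto simp: compact_imp_closed open_Compl\<close>)
  have UN: "?U \<union> - K = UNIV" using K(2) by auto
  have G: "grad_on UNIV ?F ?G"
    unfolding grad_on_def
  proof (intro conjI ballI)
    show "continuous_on UNIV ?G"
      using continuous_on_open_Un[of ?U "- K" ?G] U N K(1)
      unfolding UN grad_on_def by (auto simp: compact_imp_closed open_Compl)
    show "(?F has_derivative (\<lambda>h. ?G x \<bullet> h)) (at x)" for x
      using grad_on_has_derivative[OF U] grad_on_has_derivative[OF N] UN by blast
  qed
  have "(LINT x|lborel. ?G x \<bullet> axis i 1) = 0"
    by (rule integral_directional_derivative_eq_0[OF G K(1)]) (use \<phi>0 in auto)
  moreover have "(LINT x:D|lebesgue. f x * grad \<phi> x $ i + g x $ i * \<phi> x) = (LINT x|lborel. ?G x \<bullet> axis i 1)"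
  proof (rule integrable_zero_extension(2)[OF _ K(1) D])
    show "continuous_on UNIV (\<lambda>x. ?G x \<bullet> axis i 1)"
      using grad_on_imp_continuous_grad[OF G] by (intro continuous_intros)
    show "f x * grad \<phi> x $ i + g x $ i * \<phi> x = ?G x \<bullet> axis i 1" if "x \<in> D" for x
      using \<phi>0 K(2) by (cases "x \<in> K") (auto simp: inner_axis)
  qed (use \<phi>0 in auto)
  moreover have "(LINT x:D|lebesgue. f x * grad \<phi> x $ i + g x $ i * \<phi> x) =
      (LINT x:D|lebesgue. f x * grad \<phi> x $ i) + (LINT x:D|lebesgue. g x $ i * \<phi> x)"
    by (rule set_integral_add) (intro set_integrable_mult_test_fun \<phi> cf continuous_on_component cg)+
  ultimately show ?thesis by linarith
qed

section \<open>Criteria for membership in the Sobolev spaces\<close>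

lemma partial_eq_grad: "partial i f x = grad f x $ i"
  by (simp add: grad_def)

lemma H1_spaceI:
  assumes "u \<in> L2_space D" "g \<in> L2_space D" "grad_on (interior D) u g"
  shows "u \<in> H1_space D"
  unfolding H1_space_def partial_eq_grad
  using assms by (auto intro!: bexI[of _ g] integral_by_parts_test_fun)

lemma set_lebesgue_integral_sum:
  fixes f :: "'i \<Rightarrow> 'a \<Rightarrow> real"
  assumes "\<And>i. i \<in> I \<Longrightarrow> set_integrable M A (f i)"
  shows "(LINT x:A|M. (\<Sum>i\<in>I. f i x)) = (\<Sum>i\<in>I. LINT x:A|M. f i x)"
  unfolding set_lebesgue_integral_def scaleR_sum_right
  by (rule Bochner_Integration.integral_sum) (use assms in \<open>simp add: set_integrable_def\<close>)

text \<open>Only the sum of the diagonal derivatives must be square integrable; a single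
  \<open>G i x $ i\<close> may blow up at the boundary. Against a test function each of them still
  gives a finite integral, so one integrates by parts per component and adds afterwards.\<close>

lemma Hdiv_spaceI:
  fixes G :: "'n::finite \<Rightarrow> real^'n \<Rightarrow> real^'n"
  assumes u: "u \<in> L2_space D" and d: "d \<in> L2_space D"
    and G: "\<And>i. grad_on (interior D) (\<lambda>x. u x $ i) (G i)"
    and dG: "\<And>x. x \<in> interior D \<Longrightarrow> d x = (\<Sum>i\<in>UNIV. G i x $ i)"
  shows "u \<in> Hdiv_space D"
proof -
  have "(LINT x:D|lebesgue. u x \<bullet> grad \<phi> x) = - (LINT x:D|lebesgue. d x * \<phi> x)"
    if \<phi>: "\<phi> \<in> test_funs D" for \<phi>
  proof -
    have \<phi>0: "\<phi> x = 0" if "x \<notin> interior D" for x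
      by (rule test_funsE[OF \<phi>]) (use that in \<open>metis subsetD\<close>)
    note i1 = set_integrable_mult_test_fun(2)[OF grad_on_imp_continuous[OF G] \<phi>]
    note i2 = set_integrable_mult_test_fun(1)
      [OF continuous_on_component[OF grad_on_imp_continuous_grad[OF G]] \<phi>]
    have "(LINT x:D|lebesgue. u x \<bullet> grad \<phi> x) = (\<Sum>i\<in>UNIV. LINT x:D|lebesgue. u x $ i * grad \<phi> x $ i)"
      using i1 by (simp add: inner_vec_def set_lebesgue_integral_sum)
    also have "\<dots> = (\<Sum>i\<in>UNIV. - (LINT x:D|lebesgue. G i x $ i * \<phi> x))"
      using integral_by_parts_test_fun[OF G \<phi>] by simp
    also have "\<dots> = - (LINT x:D|lebesgue. (\<Sum>i\<in>UNIV. G i x $ i * \<phi> x))"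
      using i2 by (simp add: sum_negf set_lebesgue_integral_sum)
    also have "(LINT x:D|lebesgue. (\<Sum>i\<in>UNIV. G i x $ i * \<phi> x)) = (LINT x:D|lebesgue. d x * \<phi> x)"
      unfolding set_lebesgue_integral_def
    proof (intro Bochner_Integration.integral_cong refl)
      show "indicator D x *\<^sub>R (\<Sum>i\<in>UNIV. G i x $ i * \<phi> x) = indicator D x *\<^sub>R (d x * \<phi> x)" for x
        by (cases "x \<in> interior D") (simp_all add: dG \<phi>0 sum_distrib_right)
    qed
    finally show ?thesis .
  qed
  then show ?thesis using u d unfolding Hdiv_space_def by (auto intro!: bexI[of _ d])
qed

text \<open>As for the divergence, the single derivatives need not be square integrable, only their
  differences. The minus sign of integration by parts is absorbed by swapping the two terms of each
  difference.\<close>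

lemma Hcurl_spaceI:
  fixes u c :: "real^3 \<Rightarrow> real^3" and G :: "3 \<Rightarrow> real^3 \<Rightarrow> real^3"
  assumes u: "u \<in> L2_space D" and c: "c \<in> L2_space D"
    and G: "\<And>i. grad_on (interior D) (\<lambda>x. u x $ i) (G i)"
    and cG: "\<And>x. x \<in> interior D \<Longrightarrow>
      c x = vector [G 3 x $ 2 - G 2 x $ 3, G 1 x $ 3 - G 3 x $ 1, G 2 x $ 1 - G 1 x $ 2]"
  shows "u \<in> Hcurl_space D"
proof -
  have "(LINT x:D|lebesgue. u x \<bullet> curl \<psi> x) = (LINT x:D|lebesgue. c x \<bullet> \<psi> x)"
    if \<psi>: "\<forall>i. (\<lambda>x. \<psi> x $ i) \<in> test_funs D" for \<psi>
  proof -
    define g where "g i = grad (\<lambda>x. \<psi> x $ i)" for i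
    have \<psi>0: "\<psi> x $ i = 0" if "x \<notin> interior D" for x i
      by (rule test_funsE[OF \<psi>[rule_format, of i]]) (use that in \<open>metis subsetD\<close>)
    have i1: "set_integrable lebesgue D (\<lambda>x. u x $ i * g j x $ l)"
      and i2: "set_integrable lebesgue D (\<lambda>x. G i x $ l * \<psi> x $ j)" for i j l
      unfolding g_def
      by (rule set_integrable_mult_test_fun(2)[OF grad_on_imp_continuous[OF G] \<psi>[rule_format]],
          rule set_integrable_mult_test_fun(1)
            [OF continuous_on_component[OF grad_on_imp_continuous_grad[OF G]] \<psi>[rule_format]])
    have ibp: "(LINT x:D|lebesgue. u x $ i * g j x $ l) = - (LINT x:D|lebesgue. G i x $ l * \<psi> x $ j)" for i j l
      unfolding g_def using integral_by_parts_test_fun[OF G \<psi>[rule_format]] .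
    have ibp': "(LINT x:D|lebesgue. u x $ i * g j x $ l - u x $ i' * g j x $ l') =
        (LINT x:D|lebesgue. G i' x $ l' * \<psi> x $ j - G i x $ l * \<psi> x $ j)" for i j l i' l'
      using i1 i2 ibp by (simp add: set_integral_diff)
    have j1: "set_integrable lebesgue D (\<lambda>x. u x $ i * g j x $ l - u x $ i' * g j x $ l')"
      and j2: "set_integrable lebesgue D (\<lambda>x. G i' x $ l' * \<psi> x $ j - G i x $ l * \<psi> x $ j)" for i j l i' l'
      using i1 i2 by (auto intro: set_integral_diff)
    \<comment> \<open>The integrand is regrouped by the component of the test field that is
      differentiated, so that each group is a pair to which \<open>ibp'\<close> applies.\<close>
    have "(LINT x:D|lebesgue. u x \<bullet> curl \<psi> x) =
        (LINT x:D|lebesgue. (u x $ 2 * g 1 x $ 3 - u x $ 3 * g 1 x $ 2) +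
           ((u x $ 3 * g 2 x $ 1 - u x $ 1 * g 2 x $ 3) + (u x $ 1 * g 3 x $ 2 - u x $ 2 * g 3 x $ 1)))"
      by (simp add: inner_vec_def sum_3 curl_def partial_eq_grad g_def algebra_simps)
    also have "\<dots> = (LINT x:D|lebesgue. (G 3 x $ 2 * \<psi> x $ 1 - G 2 x $ 3 * \<psi> x $ 1) +
           ((G 1 x $ 3 * \<psi> x $ 2 - G 3 x $ 1 * \<psi> x $ 2) + (G 2 x $ 1 * \<psi> x $ 3 - G 1 x $ 2 * \<psi> x $ 3)))"
      using j1 j2 by (simp only: set_integral_add ibp')
    also have "\<dots> = (LINT x:D|lebesgue. c x \<bullet> \<psi> x)"
      unfolding set_lebesgue_integral_def
    proof (intro Bochner_Integration.integral_cong refl)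
      fix x
      show "indicator D x *\<^sub>R ((G 3 x $ 2 * \<psi> x $ 1 - G 2 x $ 3 * \<psi> x $ 1) +
           ((G 1 x $ 3 * \<psi> x $ 2 - G 3 x $ 1 * \<psi> x $ 2) + (G 2 x $ 1 * \<psi> x $ 3 - G 1 x $ 2 * \<psi> x $ 3)))
          = indicator D x *\<^sub>R (c x \<bullet> \<psi> x)"
        by (cases "x \<in> interior D")
           (auto simp: inner_vec_def sum_3 cG \<psi>0 algebra_simps)
    qed
    finally show ?thesis .
  qed
  then show ?thesis using u c unfolding Hcurl_space_def by (auto intro!: bexI[of _ c])
qed

section \<open>Gradients of polynomials\<close>

lemma grad_on_sum:
  assumes "\<And>i. i \<in> I \<Longrightarrow> grad_on S (f i) (g i)"
  shows "grad_on S (\<lambda>x. \<Sum>i\<in>I. f i x) (\<lambda>x. \<Sum>i\<in>I. g i x)"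
  using assms
  by (induction I rule: infinite_finite_induct) (auto intro: grad_on_const grad_on_add)

lemma grad_on_component: "grad_on S (\<lambda>x::real^'n::finite. x $ i) (\<lambda>x. axis i 1)"
  using grad_on_inner[of S "axis i 1"] by (simp add: inner_axis' )

definition continuously_differentiable :: "('a::euclidean_space \<Rightarrow> real) \<Rightarrow> bool" where
  "continuously_differentiable f \<longleftrightarrow> (\<exists>g. grad_on UNIV f g)"

named_theorems cd_intros

lemma continuously_differentiable_const [cd_intros]: "continuously_differentiable (\<lambda>x. c)"
  unfolding continuously_differentiable_def using grad_on_const by blast

lemma continuously_differentiable_add [cd_intros]:
  "continuously_differentiable f \<Longrightarrow> continuously_differentiable g \<Longrightarrow>
    continuously_differentiable (\<lambda>x. f x + g x)"
  unfolding continuously_differentiable_def using grad_on_add by blast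

lemma continuously_differentiable_diff [cd_intros]:
  "continuously_differentiable f \<Longrightarrow> continuously_differentiable g \<Longrightarrow>
    continuously_differentiable (\<lambda>x. f x - g x)"
  unfolding continuously_differentiable_def using grad_on_diff by blast

lemma continuously_differentiable_mult [cd_intros]:
  "continuously_differentiable f \<Longrightarrow> continuously_differentiable g \<Longrightarrow>
    continuously_differentiable (\<lambda>x. f x * g x)"
  unfolding continuously_differentiable_def using grad_on_mult by blast

lemma continuously_differentiable_power [cd_intros]:
  "continuously_differentiable f \<Longrightarrow> continuously_differentiable (\<lambda>x. f x ^ n)"
  unfolding continuously_differentiable_def using grad_on_power by blast

lemma continuously_differentiable_sum [cd_intros]:
  assumes "\<And>i. i \<in> I \<Longrightarrow> continuously_differentiable (f i)"
  shows "continuously_differentiable (\<lambda>x. \<Sum>i\<in>I. f i x)"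
  using assms
  by (induction I rule: infinite_finite_induct) (auto intro: cd_intros)

lemma grad_on_fst: "grad_on S (\<lambda>v::real \<times> real \<times> real. fst v) (\<lambda>v. (1, 0, 0))"
  using grad_on_inner[of S "(1, 0, 0) :: real \<times> real \<times> real"] by (simp add: inner_prod_def)

lemma grad_on_fst_snd: "grad_on S (\<lambda>v::real \<times> real \<times> real. fst (snd v)) (\<lambda>v. (0, 1, 0))"
  using grad_on_inner[of S "(0, 1, 0) :: real \<times> real \<times> real"] by (simp add: inner_prod_def)

lemma grad_on_snd_snd: "grad_on S (\<lambda>v::real \<times> real \<times> real. snd (snd v)) (\<lambda>v. (0, 0, 1))"
  using grad_on_inner[of S "(0, 0, 1) :: real \<times> real \<times> real"] by (simp add: inner_prod_def)

lemma continuously_differentiable_proj [cd_intros]: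
  "continuously_differentiable (\<lambda>v::real \<times> real \<times> real. fst v)"
  "continuously_differentiable (\<lambda>v::real \<times> real \<times> real. fst (snd v))"
  "continuously_differentiable (\<lambda>v::real \<times> real \<times> real. snd (snd v))"
  unfolding continuously_differentiable_def
  using grad_on_fst grad_on_fst_snd grad_on_snd_snd by blast+

lemma continuously_differentiable_imp_continuous:
  "continuously_differentiable f \<Longrightarrow> continuous_on UNIV f"
  unfolding continuously_differentiable_def using grad_on_imp_continuous by blast

lemma continuous_on_vector3:
  fixes f g h :: "'a::topological_space \<Rightarrow> real"
  assumes "continuous_on S f" "continuous_on S g" "continuous_on S h"
  shows "continuous_on S (\<lambda>x. vector [f x, g x, h x] :: real^3)"
proof -
  have "(\<lambda>x. vector [f x, g x, h x] :: real^3) =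
      (\<lambda>x. f x *\<^sub>R axis 1 1 + g x *\<^sub>R axis 2 1 + h x *\<^sub>R axis 3 1)"
    by (simp add: fun_eq_iff vec_eq_iff forall_3 axis_def)
  then show ?thesis using assms by (simp only:) (intro continuous_intros)
qed

text \<open>Functions of the horizontal coordinates are regarded as functions of all three coordinates.\<close>

lemma grad_on_Qpoly2:
  assumes "r \<in> Qpoly2 l m"
  obtains r1 r2 r11 r12 r22 :: "real \<times> real \<times> real \<Rightarrow> real"
  where "grad_on UNIV (\<lambda>(x, y, w). r x y) (\<lambda>v. (r1 v, r2 v, 0))"
    "grad_on UNIV r1 (\<lambda>v. (r11 v, r12 v, 0))" "grad_on UNIV r2 (\<lambda>v. (r12 v, r22 v, 0))"
proof -
  obtain c where r: "r = (\<lambda>x y. \<Sum>a | int a \<le> l. \<Sum>b | int b \<le> m. c a b * x^a * y^b)"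
    using assms by (auto simp: Qpoly2_def)
  \<comment> \<open>\<open>M i j\<close> is the partial derivative of order \<open>i\<close> in
    \<open>x\<close> and \<open>j\<close> in \<open>y\<close>. Truncated subtraction is harmless:
    for \<open>i > a\<close> the product contains the factor \<open>real (a - a) = 0\<close>, and
    likewise for \<open>j > b\<close>.\<close>
  define M where "M i j v = (\<Sum>a | int a \<le> l. \<Sum>b | int b \<le> m.
     c a b * ((\<Prod>n<i. real (a - n)) * fst v ^ (a - i)) *
       ((\<Prod>n<j. real (b - n)) * fst (snd v) ^ (b - j)))"
    for i j and v :: "real \<times> real \<times> real"
  have M: "grad_on UNIV (M i j) (\<lambda>v. (M (Suc i) j v, M i (Suc j) v, 0))" for i j
  proof (rule grad_on_cong)
    show "grad_on UNIV (M i j) (\<lambda>v. \<Sum>a | int a \<le> l. \<Sum>b | int b \<le> m.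
       (c a b * ((\<Prod>n<i. real (a - n)) * fst v ^ (a - i))) *\<^sub>R
         ((\<Prod>n<j. real (b - n)) *\<^sub>R ((real (b - j) * fst (snd v) ^ (b - j - 1)) *\<^sub>R (0, 1, 0)) +
            fst (snd v) ^ (b - j) *\<^sub>R 0)
       + ((\<Prod>n<j. real (b - n)) * fst (snd v) ^ (b - j)) *\<^sub>R
         (c a b *\<^sub>R ((\<Prod>n<i. real (a - n)) *\<^sub>R ((real (a - i) * fst v ^ (a - i - 1)) *\<^sub>R (1, 0, 0)) +
            fst v ^ (a - i) *\<^sub>R 0) + ((\<Prod>n<i. real (a - n)) * fst v ^ (a - i)) *\<^sub>R 0))"
      unfolding M_def
      by (intro grad_on_sum grad_on_mult grad_on_const grad_on_power grad_on_fst grad_on_fst_snd)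
  next
    fix v
    show "(\<Sum>a | int a \<le> l. \<Sum>b | int b \<le> m.
       (c a b * ((\<Prod>n<i. real (a - n)) * fst v ^ (a - i))) *\<^sub>R
         ((\<Prod>n<j. real (b - n)) *\<^sub>R ((real (b - j) * fst (snd v) ^ (b - j - 1)) *\<^sub>R (0, 1, 0)) +
            fst (snd v) ^ (b - j) *\<^sub>R 0)
       + ((\<Prod>n<j. real (b - n)) * fst (snd v) ^ (b - j)) *\<^sub>R
         (c a b *\<^sub>R ((\<Prod>n<i. real (a - n)) *\<^sub>R ((real (a - i) * fst v ^ (a - i - 1)) *\<^sub>R (1, 0, 0)) +
            fst v ^ (a - i) *\<^sub>R 0) + ((\<Prod>n<i. real (a - n)) * fst v ^ (a - i)) *\<^sub>R 0))
       = (M (Suc i) j v, M i (Suc j) v, 0)"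
      by (auto simp: M_def prod_eq_iff fst_sum snd_sum intro!: sum.cong)
  qed auto
  have "M 0 0 = (\<lambda>(x, y, w). r x y)" by (auto simp: M_def r)
  with M[of 0 0] show ?thesis
    by (intro that[of "M (Suc 0) 0" "M 0 (Suc 0)", OF _ M M]) simp
qed

text \<open>Translates the one-variable \<open>deriv\<close> in the definitions of the spaces into
  gradient components; \<open>w\<close> is arbitrary because \<open>r\<close> does not depend on
  it.\<close>

lemma deriv_eq_grad:
  assumes "grad_on UNIV (\<lambda>(x, y, w). r x y) (\<lambda>v. (r1 v, r2 v, 0))"
  shows "deriv (\<lambda>t. r t y) x = r1 (x, y, w)" "deriv (\<lambda>t. r x t) y = r2 (x, y, w)"
proof -
  have d: "((\<lambda>(x, y, w). r x y) has_derivative (\<lambda>h. (r1 (x, y, w), r2 (x, y, w), 0) \<bullet> h)) (at (x, y, w))"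
    using grad_on_has_derivative[OF assms] by simp
  have "((\<lambda>t. (t, y, w)) has_derivative (\<lambda>t. (t, 0, 0))) (at x)"
    by (intro has_derivative_Pair has_derivative_ident has_derivative_const)
  from has_derivative_compose[OF this d]
  have "((\<lambda>t. r t y) has_derivative (\<lambda>h. (r1 (x, y, w), r2 (x, y, w), 0) \<bullet> (h, 0, 0))) (at x)"
    by simp
  then show "deriv (\<lambda>t. r t y) x = r1 (x, y, w)"
    by (intro DERIV_imp_deriv) (simp add: has_field_derivative_def inner_prod_def)
  have "((\<lambda>t. (x, t, w)) has_derivative (\<lambda>t. (0, t, 0))) (at y)"
    by (intro has_derivative_Pair has_derivative_ident has_derivative_const)
  from has_derivative_compose[OF this d]
  have "((\<lambda>t. r x t) has_derivative (\<lambda>h. (r1 (x, y, w), r2 (x, y, w), 0) \<bullet> (0, h, 0))) (at y)"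
    by simp
  then show "deriv (\<lambda>t. r x t) y = r2 (x, y, w)"
    by (intro DERIV_imp_deriv) (simp add: has_field_derivative_def inner_prod_def)
qed

section \<open>Coordinates on the pyramid\<close>

text \<open>The third coordinate is \<open>w = 1 - \<zeta> = 1 / (1 + z)\<close>, which tends to zero at the apex.\<close>

definition chart :: "real^3 \<Rightarrow> real \<times> real \<times> real" where
  "chart p = (p$1 / (1 - p$3), p$2 / (1 - p$3), 1 - p$3)"

text \<open>Inverse of \<open>pyr_map\<close> off the apex. The horizontal coordinates are those of
  \<open>chart\<close>; the vertical one is \<open>z\<close> in place of \<open>w\<close>.\<close>

definition pyr_inv :: "real^3 \<Rightarrow> real^3" where
  "pyr_inv p = vector [p$1 / (1 - p$3), p$2 / (1 - p$3), p$3 / (1 - p$3)]"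

abbreviation below_apex :: "(real^3) set" where
  "below_apex \<equiv> {p. p$3 < 1}"

abbreviation (input) cx :: "real^3 \<Rightarrow> real" where "cx p \<equiv> p$1 / (1 - p$3)"
abbreviation (input) cy :: "real^3 \<Rightarrow> real" where "cy p \<equiv> p$2 / (1 - p$3)"
abbreviation (input) cw :: "real^3 \<Rightarrow> real" where "cw p \<equiv> 1 - p$3"

lemma chart_simps [simp]:
  "fst (chart p) = cx p" "fst (snd (chart p)) = cy p" "snd (snd (chart p)) = cw p"
  by (simp_all add: chart_def)

lemma open_below_apex: "open below_apex"
  by (intro open_Collect_less continuous_intros)

lemma grad_on_height: "grad_on S cw (\<lambda>p. vector [0, 0, -1])"
  by (rule grad_on_subset[OF grad_on_cong[OF grad_on_diff[OF grad_on_const grad_on_component] open_UNIV]])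
     (auto simp: vec_eq_iff forall_3 axis_def)

text \<open>The order \<open>1 / w\<close> of this gradient and the next is the only source of
  singularity at the apex.\<close>

lemma grad_on_cx: "grad_on below_apex cx (\<lambda>p. vector [1 / cw p, 0, cx p / cw p])"
  unfolding divide_inverse
  by (rule grad_on_cong[OF grad_on_mult[OF grad_on_component grad_on_inverse[OF grad_on_height]] open_below_apex])
     (auto simp: vec_eq_iff forall_3 axis_def power2_eq_square)

lemma grad_on_cy: "grad_on below_apex cy (\<lambda>p. vector [0, 1 / cw p, cy p / cw p])"
  unfolding divide_inverse
  by (rule grad_on_cong[OF grad_on_mult[OF grad_on_component grad_on_inverse[OF grad_on_height]] open_below_apex])
     (auto simp: vec_eq_iff forall_3 axis_def power2_eq_square)

lemma continuous_on_chart: "continuous_on below_apex chart"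
  unfolding chart_def
  by (intro continuous_on_Pair grad_on_imp_continuous[OF grad_on_cx]
      grad_on_imp_continuous[OF grad_on_cy] grad_on_imp_continuous[OF grad_on_height])

lemma continuous_on_comp_chart:
  "continuous_on UNIV F \<Longrightarrow> continuous_on below_apex (\<lambda>p. F (chart p))"
  using continuous_on_compose2[OF _ continuous_on_chart] by blast

text \<open>Chain rule: the derivatives in \<open>x\<close> and \<open>y\<close> carry a factor
  \<open>1 / w\<close>, the one in \<open>w\<close> only the sign of the derivative of
  \<open>1 - \<zeta>\<close>.\<close>

lemma grad_on_comp_chart:
  assumes P: "grad_on UNIV P (\<lambda>v. (Px v, Py v, Pw v))"
  shows "grad_on below_apex (\<lambda>p. P (chart p))
    (\<lambda>p. vector [Px (chart p) / cw p, Py (chart p) / cw p,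
       (cx p * Px (chart p) + cy p * Py (chart p)) / cw p - Pw (chart p)])"
  unfolding grad_on_def
proof (intro conjI ballI)
  have "continuous_on UNIV (\<lambda>v. (Px v, Py v, Pw v))" using P by (rule grad_on_imp_continuous_grad)
  note c = this[THEN continuous_on_fst, simplified]
    this[THEN continuous_on_snd, THEN continuous_on_fst, simplified]
    this[THEN continuous_on_snd, THEN continuous_on_snd, simplified]
  show "continuous_on below_apex (\<lambda>p. vector [Px (chart p) / cw p, Py (chart p) / cw p,
       (cx p * Px (chart p) + cy p * Py (chart p)) / cw p - Pw (chart p)] :: real^3)"
    by (intro continuous_on_vector3 continuous_intros continuous_on_comp_chart c) auto
  fix p :: "real^3" assume p: "p \<in> below_apex"
  let ?x = "vector [1 / cw p, 0, cx p / cw p] :: real^3"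
  let ?y = "vector [0, 1 / cw p, cy p / cw p] :: real^3"
  let ?w = "vector [0, 0, -1] :: real^3"
  have "(chart has_derivative (\<lambda>h. (?x \<bullet> h, ?y \<bullet> h, ?w \<bullet> h))) (at p)"
    unfolding chart_def
    using grad_on_has_derivative[OF grad_on_cx p] grad_on_has_derivative[OF grad_on_cy p]
      grad_on_has_derivative[OF grad_on_height p]
    by (intro has_derivative_Pair)
  moreover have "(P has_derivative (\<lambda>h. (Px (chart p), Py (chart p), Pw (chart p)) \<bullet> h)) (at (chart p))"
    using grad_on_has_derivative[OF P] by simp
  ultimately have "((\<lambda>p. P (chart p)) has_derivative
    (\<lambda>h. (Px (chart p), Py (chart p), Pw (chart p)) \<bullet> (?x \<bullet> h, ?y \<bullet> h, ?w \<bullet> h))) (at p)"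
    by (rule has_derivative_compose)
  also have "(\<lambda>h. (Px (chart p), Py (chart p), Pw (chart p)) \<bullet> (?x \<bullet> h, ?y \<bullet> h, ?w \<bullet> h)) =
     (\<lambda>h. vector [Px (chart p) / cw p, Py (chart p) / cw p,
       (cx p * Px (chart p) + cy p * Py (chart p)) / cw p - Pw (chart p)] \<bullet> h)"
    by (simp add: fun_eq_iff inner_prod_def inner_vec_def sum_3 distrib_left distrib_right
        left_diff_distrib right_diff_distrib add_divide_distrib mult_ac)
  finally show "((\<lambda>p. P (chart p)) has_derivative
     (\<lambda>h. vector [Px (chart p) / cw p, Py (chart p) / cw p,
       (cx p * Px (chart p) + cy p * Py (chart p)) / cw p - Pw (chart p)] \<bullet> h)) (at p)" .
qed

text \<open>The prefactor cancels the single \<open>1 / w\<close> of the chain rule. That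
  \<open>G\<close> is continuous also at \<open>w = 0\<close> is what makes the gradient bounded
  near the apex.\<close>

lemma grad_on_height_mult_chart:
  assumes "continuously_differentiable P"
  obtains G :: "real \<times> real \<times> real \<Rightarrow> real^3" where "continuous_on UNIV G"
    "grad_on below_apex (\<lambda>p. cw p * P (chart p)) (\<lambda>p. G (chart p))"
proof -
  obtain g where g: "grad_on UNIV P g"
    using assms by (auto simp: continuously_differentiable_def)
  let ?Px = "\<lambda>v. fst (g v)" and ?Py = "\<lambda>v. fst (snd (g v))" and ?Pw = "\<lambda>v. snd (snd (g v))"
  let ?G = "\<lambda>v. vector [?Px v, ?Py v, fst v * ?Px v + fst (snd v) * ?Py v - snd (snd v) * ?Pw v - P v] :: real^3"
  have "grad_on UNIV P (\<lambda>v. (?Px v, ?Py v, ?Pw v))" using g by simp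
  from grad_on_mult[OF grad_on_height grad_on_comp_chart[OF this]]
  have "grad_on below_apex (\<lambda>p. cw p * P (chart p)) (\<lambda>p. ?G (chart p))"
    by (rule grad_on_cong[OF _ open_below_apex])
       (auto simp: vec_eq_iff forall_3 right_diff_distrib)
  moreover have "continuous_on UNIV ?G"
    using grad_on_imp_continuous[OF g] grad_on_imp_continuous_grad[OF g]
    by (intro continuous_on_vector3 continuous_intros)
  ultimately show ?thesis by (intro that)
qed

section \<open>The pyramid in the new coordinates and square integrability\<close>

lemma pyramid_apex: "p \<in> pyramid \<Longrightarrow> p $ 3 < 1 \<or> p = vector [0, 0, 1]"
  unfolding pyramid_def by (auto simp: vec_eq_iff forall_3)

lemma interior_pyramid: "interior pyramid \<subseteq> {p \<in> pyramid. p $ 3 < 1}"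
proof
  fix p assume p: "p \<in> interior pyramid"
  then obtain e where e: "e > 0" "cball p e \<subseteq> pyramid" by (meson mem_interior_cball)
  \<comment> \<open>Room to move upwards inside the pyramid excludes the apex: it forces
    \<open>p $ 3 + e \<le> 1\<close>.\<close>
  have "p + e *\<^sub>R axis 3 1 \<in> cball p e" using e(1) by (simp add: dist_norm)
  then have "p + e *\<^sub>R axis 3 1 \<in> pyramid" using e(2) by blast
  then have "p $ 3 < 1" using e(1) by (auto simp: pyramid_def axis_def)
  then show "p \<in> {p \<in> pyramid. p $ 3 < 1}" using p interior_subset by blast
qed

lemma chart_in_cube:
  assumes "p \<in> pyramid" "p $ 3 < 1"
  shows "chart p \<in> {0..1} \<times> {0..1} \<times> {0..1}"
  using assms by (auto simp: chart_def pyramid_def divide_le_eq_1)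

lemma compact_pyramid: "compact pyramid"
  unfolding compact_eq_bounded_closed
proof
  have "pyramid \<subseteq> cbox 0 (\<chi> i. 1)"
    by (auto simp: pyramid_def mem_box_cart forall_3)
  then show "bounded pyramid" using bounded_cbox bounded_subset by blast
  show "closed pyramid"
    unfolding pyramid_def by (intro closed_Collect_conj closed_Collect_le continuous_intros)
qed

text \<open>\<open>chart\<close> sends the pyramid without its apex into the compact unit cube,
  where \<open>F\<close> is bounded; a bounded measurable function on a bounded set is square
  integrable.\<close>

lemma L2_space_pyramidI:
  fixes F :: "real \<times> real \<times> real \<Rightarrow> 'b::euclidean_space"
  assumes F: "continuous_on UNIV F" and u: "\<And>p. p \<in> pyramid \<Longrightarrow> p $ 3 < 1 \<Longrightarrow> u p = F (chart p)"
  shows "u \<in> L2_space pyramid"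
proof -
  let ?a = "vector [0, 0, 1] :: real^3" and ?P = "pyramid \<inter> below_apex"
  have [measurable]: "pyramid \<in> sets borel" "below_apex \<in> sets borel"
    using compact_pyramid open_below_apex by (auto simp: compact_imp_closed)
  have a: "?a \<in> pyramid" by (simp add: pyramid_def)
  have "bounded (F ` ({0..1} \<times> {0..1} \<times> {0..1}))"
    by (intro compact_imp_bounded compact_continuous_image continuous_on_subset[OF F] compact_Times) auto
  then obtain B0 where B0: "\<And>v. v \<in> {0..1} \<times> {0..1} \<times> {0..1} \<Longrightarrow> norm (F v) \<le> B0"
    unfolding bounded_iff by blast
  \<comment> \<open>The value of \<open>u\<close> at the apex is arbitrary, so it enters the bound
    separately.\<close>
  define B where "B = max B0 (norm (u ?a))"
  have B: "norm (u p) \<le> B" if "p \<in> pyramid" for p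
    using pyramid_apex[OF that] B0[OF chart_in_cube[OF that]] u[OF that]
    by (auto simp: B_def max_def)
  have eq: "(\<lambda>p. indicator pyramid p *\<^sub>R u p) =
      (\<lambda>p. indicator ?P p *\<^sub>R F (chart p) + indicator {?a} p *\<^sub>R u ?a)"
  proof
    fix p
    show "indicator pyramid p *\<^sub>R u p = indicator ?P p *\<^sub>R F (chart p) + indicator {?a} p *\<^sub>R u ?a"
      using pyramid_apex[of p] u[of p] a by (cases "p \<in> pyramid"; cases "p $ 3 < 1") (auto simp: indicator_def)
  qed
  have "(\<lambda>p. indicator ?P p *\<^sub>R F (chart p)) \<in> borel_measurable borel"
    by (rule borel_measurable_continuous_on_indicator)
       (auto intro: continuous_on_subset[OF continuous_on_comp_chart[OF F]])
  then have "(\<lambda>p. indicator pyramid p *\<^sub>R u p) \<in> borel_measurable borel"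
    unfolding eq by measurable
  then have m: "(\<lambda>p. indicator pyramid p *\<^sub>R u p) \<in> borel_measurable lebesgue"
    by (intro measurable_completion) simp
  have "set_integrable lebesgue pyramid (\<lambda>p. (norm (u p))\<^sup>2)"
    unfolding set_integrable_def
  proof (rule Bochner_Integration.integrable_bound)
    have "integrable lborel (\<lambda>p::real^3. indicator pyramid p *\<^sub>R B\<^sup>2)"
      by (rule borel_integrable_compact[OF compact_pyramid]) auto
    then show "integrable lebesgue (\<lambda>p::real^3. indicator pyramid p *\<^sub>R B\<^sup>2)"
      by (simp add: integrable_completion)
    have "(\<lambda>p. indicator pyramid p *\<^sub>R (norm (u p))\<^sup>2) = (\<lambda>p. (norm (indicator pyramid p *\<^sub>R u p))\<^sup>2)"
      by (auto simp: indicator_def fun_eq_iff)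
    then show "(\<lambda>p. indicator pyramid p *\<^sub>R (norm (u p))\<^sup>2) \<in> borel_measurable lebesgue"
      using borel_measurable_power[OF measurable_compose[OF m borel_measurable_norm], of 2] by (simp only:)
    show "AE p in lebesgue. norm (indicator pyramid p *\<^sub>R (norm (u p))\<^sup>2) \<le> norm (indicator pyramid p *\<^sub>R B\<^sup>2)"
      using B by (auto simp: indicator_def power_mono)
  qed
  with m show ?thesis by (simp add: L2_space_def set_borel_measurable_def)
qed

section \<open>Pullbacks along the map of the infinite pyramid\<close>

lemma pyr_map_pyr_inv: "p $ 3 < 1 \<Longrightarrow> pyr_map (pyr_inv p) = p"
  by (auto simp: pyr_map_def pyr_inv_def vec_eq_iff forall_3 field_simps)

lemma pyr_inv_in_inf_pyramid: "p \<in> pyramid \<Longrightarrow> p $ 3 < 1 \<Longrightarrow> pyr_inv p \<in> inf_pyramid"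
  by (auto simp: pyr_inv_def inf_pyramid_def pyramid_def divide_le_eq_1)

lemma jacobian_pyr_map:
  assumes p: "p $ 3 \<noteq> -1"
  shows "jacobian pyr_map (at p) = vector
    [vector [1 / (1 + p$3), 0, - p$1 / (1 + p$3)\<^sup>2],
     vector [0, 1 / (1 + p$3), - p$2 / (1 + p$3)\<^sup>2],
     vector [0, 0, 1 / (1 + p$3)\<^sup>2]]"
proof -
  note c = bounded_linear.has_derivative[OF bounded_linear_vec_nth has_derivative_ident]
  have nz: "1 + p $ 3 \<noteq> 0" using p by linarith
  have q: "((\<lambda>p. p $ i / (1 + p $ 3)) has_derivative
      (\<lambda>h. h $ i / (1 + p $ 3) - p $ i * h $ 3 / (1 + p $ 3)\<^sup>2)) (at p)" for i :: 3
    using has_derivative_divide'[OF c[of i] has_derivative_add[OF has_derivative_const[of 1] c[of 3]] nz] nz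
    by (simp add: diff_divide_distrib power2_eq_square)
  let ?f = "\<lambda>h. (h $ 1 / (1 + p $ 3) - p $ 1 * h $ 3 / (1 + p $ 3)\<^sup>2) *\<^sub>R axis 1 1
    + (h $ 2 / (1 + p $ 3) - p $ 2 * h $ 3 / (1 + p $ 3)\<^sup>2) *\<^sub>R axis 2 1
    + (h $ 3 / (1 + p $ 3) - p $ 3 * h $ 3 / (1 + p $ 3)\<^sup>2) *\<^sub>R (axis 3 1 :: real^3)"
  have "((\<lambda>p. (p $ 1 / (1 + p $ 3)) *\<^sub>R axis 1 1 + (p $ 2 / (1 + p $ 3)) *\<^sub>R axis 2 1
       + (p $ 3 / (1 + p $ 3)) *\<^sub>R (axis 3 1 :: real^3)) has_derivative ?f) (at p)"
    by (intro has_derivative_add has_derivative_scaleR_left q)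
  also have "(\<lambda>p. (p $ 1 / (1 + p $ 3)) *\<^sub>R axis 1 1 + (p $ 2 / (1 + p $ 3)) *\<^sub>R axis 2 1
       + (p $ 3 / (1 + p $ 3)) *\<^sub>R (axis 3 1 :: real^3)) = pyr_map"
    by (simp add: pyr_map_def fun_eq_iff vec_eq_iff forall_3 axis_def)
  finally have "frechet_derivative pyr_map (at p) = ?f"
    by (rule frechet_derivative_at[symmetric])
  moreover have "1 / (1 + p $ 3) - p $ 3 / (1 + p $ 3)\<^sup>2 = 1 / (1 + p $ 3)\<^sup>2"
    using nz by (simp add: divide_simps power2_eq_square)
  ultimately show ?thesis
    by (simp add: jacobian_def matrix_def vec_eq_iff forall_3 axis_def)
qed

lemma jacobian_pyr_map_pyr_inv:
  assumes p: "p $ 3 < 1"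
  shows "jacobian pyr_map (at (pyr_inv p)) = vector
    [vector [cw p, 0, - cx p * (cw p)\<^sup>2], vector [0, cw p, - cy p * (cw p)\<^sup>2],
     vector [0, 0, (cw p)\<^sup>2]]"
proof -
  have w: "1 + pyr_inv p $ 3 = 1 / cw p"
    using p by (simp add: pyr_inv_def field_simps)
  have "pyr_inv p $ 3 \<noteq> -1" using w p by auto
  from jacobian_pyr_map[OF this] show ?thesis
    unfolding w using p by (simp add: pyr_inv_def power_one_over)
qed

lemma det_jacobian_pyr_map: "p $ 3 < 1 \<Longrightarrow> det (jacobian pyr_map (at (pyr_inv p))) = cw p ^ 4"
  by (simp add: jacobian_pyr_map_pyr_inv det_3 power2_eq_square power4_eq_xxxx)

lemma pullback0_pyr_inv: "p $ 3 < 1 \<Longrightarrow> u p = pullback0 pyr_map u (pyr_inv p)"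
  by (simp add: pullback0_def pyr_map_pyr_inv)

text \<open>Back substitution in the triangular system given by the transposed Jacobian. The
  divisors show the cost: one factor \<open>w\<close> for the first two components of
  \<open>e\<close>, two for the third.\<close>

lemma pullback1_pyr_inv:
  assumes p: "p $ 3 < 1" and e: "e = pullback1 pyr_map u (pyr_inv p)"
  shows "u p = vector [e$1 / cw p, e$2 / cw p, (cx p * e$1 + cy p * e$2 + e$3 / cw p) / cw p]"
proof -
  define w x y where "w = cw p" and "x = cx p" and "y = cy p"
  have w: "w \<noteq> 0" using p by (simp add: w_def)
  have "e $ 1 = w * u p $ 1" "e $ 2 = w * u p $ 2"
    "e $ 3 = w\<^sup>2 * (u p $ 3 - x * u p $ 1 - y * u p $ 2)"
    unfolding e pullback1_def pyr_map_pyr_inv[OF p] jacobian_pyr_map_pyr_inv[OF p]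
      x_def[symmetric] y_def[symmetric] unfolding w_def[symmetric]
    by (simp_all add: matrix_vector_mult_def sum_3 transpose_def algebra_simps)
  then show ?thesis
    unfolding x_def[symmetric] y_def[symmetric] unfolding w_def[symmetric] using w
    by (simp add: vec_eq_iff forall_3 field_simps power2_eq_square)
qed

text \<open>Applying the Jacobian to \<open>e\<close> removes its inverse and leaves
  \<open>w^4\<close> times \<open>u p\<close>. The cost is three factors \<open>w\<close> for the
  first two components of \<open>e\<close> and two for the third.\<close>

lemma pullback2_pyr_inv:
  assumes p: "p $ 3 < 1" and e: "e = pullback2 pyr_map u (pyr_inv p)"
  shows "u p = vector [(e$1 - cx p * cw p * e$3) / cw p ^ 3,
    (e$2 - cy p * cw p * e$3) / cw p ^ 3, e$3 / cw p ^ 2]"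
proof -
  define w x y where "w = cw p" and "x = cx p" and "y = cy p"
  have w: "w \<noteq> 0" using p by (simp add: w_def)
  let ?J = "jacobian pyr_map (at (pyr_inv p))"
  have det: "det ?J = w ^ 4" using det_jacobian_pyr_map[OF p] by (simp add: w_def)
  then have "invertible ?J" using w by (simp add: invertible_det_nz)
  then have inv: "?J ** matrix_inv ?J = mat 1"
    by (simp add: invertible_def matrix_inv_def someI_ex) (metis (mono_tags, lifting) someI_ex)
  have "?J *v e = w ^ 4 *\<^sub>R (?J *v (matrix_inv ?J *v u p))"
    unfolding e pullback2_def pyr_map_pyr_inv[OF p] det by (rule matrix_vector_mult_scaleR)
  also have "\<dots> = w ^ 4 *\<^sub>R u p"
    by (simp add: matrix_vector_mul_assoc inv)
  finally have J: "(?J *v e) $ i = w ^ 4 * u p $ i" for i by simp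
  have "w * e $ 1 - x * w\<^sup>2 * e $ 3 = w ^ 4 * u p $ 1" "w * e $ 2 - y * w\<^sup>2 * e $ 3 = w ^ 4 * u p $ 2"
    "w\<^sup>2 * e $ 3 = w ^ 4 * u p $ 3"
    using J[of 1] J[of 2] J[of 3]
    unfolding jacobian_pyr_map_pyr_inv[OF p] x_def[symmetric] y_def[symmetric]
    unfolding w_def[symmetric]
    by (simp_all add: matrix_vector_mult_def sum_3)
  then have "w * (e $ 1 - x * w * e $ 3) = w * (w ^ 3 * u p $ 1)"
    "w * (e $ 2 - y * w * e $ 3) = w * (w ^ 3 * u p $ 2)" "w\<^sup>2 * e $ 3 = w\<^sup>2 * (w\<^sup>2 * u p $ 3)"
    by (simp_all add: algebra_simps power2_eq_square power3_eq_cube power4_eq_xxxx)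
  then have "e $ 1 - x * w * e $ 3 = w ^ 3 * u p $ 1"
    "e $ 2 - y * w * e $ 3 = w ^ 3 * u p $ 2" "e $ 3 = w\<^sup>2 * u p $ 3"
    using w by (simp_all only: mult_left_cancel power_not_zero not_False_eq_True)
  then show ?thesis
    unfolding x_def[symmetric] y_def[symmetric] unfolding w_def[symmetric] using w
    by (simp add: vec_eq_iff forall_3)
qed

lemma pullback3_pyr_inv:
  "p $ 3 < 1 \<Longrightarrow> u p = pullback3 pyr_map u (pyr_inv p) / cw p ^ 4"
  by (simp add: pullback3_def pyr_map_pyr_inv det_jacobian_pyr_map)

text \<open>With \<open>z = (1 - w) / w\<close> and \<open>1 + z = 1 / w\<close> the quotient is
  \<open>(1 - w)^d * w^(k - d)\<close>; \<open>j\<close> of the factors \<open>w\<close> are set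
  aside.\<close>

lemma pyr_inv_power:
  assumes "p $ 3 < 1" "d + j \<le> k"
  shows "(pyr_inv p $ 3) ^ d / (1 + pyr_inv p $ 3) ^ k = cw p ^ j * ((1 - cw p) ^ d * cw p ^ (k - d - j))"
proof -
  obtain i where k: "k = d + j + i" using assms(2) le_Suc_ex by blast
  have w: "1 + pyr_inv p $ 3 = 1 / cw p"
    using assms by (simp add: pyr_inv_def field_simps)
  show ?thesis
    unfolding w k using assms by (simp add: pyr_inv_def power_add power_divide field_simps)
qed

text \<open>The gap between the exponent of the denominator and the degree in \<open>z\<close>
  yields \<open>j\<close> factors \<open>w\<close> in every monomial, with a polynomial cofactor.
  For negative \<open>n\<close> the sum is empty and the cofactor zero.\<close>

lemma Qrat_pyr_inv:
  assumes "q \<in> Qrat k l m n" "n + int j \<le> int k"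
  obtains Q where "continuously_differentiable Q"
    "\<And>p. p \<in> pyramid \<Longrightarrow> p $ 3 < 1 \<Longrightarrow> q (pyr_inv p) = cw p ^ j * Q (chart p)"
proof -
  obtain c where c: "\<And>p. p \<in> inf_pyramid \<Longrightarrow> q p = (\<Sum>a | int a \<le> l. \<Sum>b | int b \<le> m. \<Sum>d | int d \<le> n.
      c a b d * (p$1)^a * (p$2)^b * (p$3)^d) / (1 + p$3)^k"
    using assms(1) by (auto simp: Qrat_def Qpoly3_def)
  define Q :: "real \<times> real \<times> real \<Rightarrow> real" where
    "Q v = (\<Sum>a | int a \<le> l. \<Sum>b | int b \<le> m. \<Sum>d | int d \<le> n. c a b d * fst v ^ a * fst (snd v) ^ b *
       ((1 - snd (snd v)) ^ d * snd (snd v) ^ (k - d - j)))" for v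
  show ?thesis
  proof
    show "continuously_differentiable Q"
      unfolding Q_def by (intro cd_intros)
    fix p assume p: "p \<in> pyramid" "p $ 3 < 1"
    have "q (pyr_inv p) = (\<Sum>a | int a \<le> l. \<Sum>b | int b \<le> m. \<Sum>d | int d \<le> n.
       c a b d * (pyr_inv p $ 1)^a * (pyr_inv p $ 2)^b * ((pyr_inv p $ 3)^d / (1 + pyr_inv p $ 3)^k))"
      unfolding c[OF pyr_inv_in_inf_pyramid[OF p]] by (simp add: sum_divide_distrib)
    also have "\<dots> = (\<Sum>a | int a \<le> l. \<Sum>b | int b \<le> m. \<Sum>d | int d \<le> n.
       c a b d * (pyr_inv p $ 1)^a * (pyr_inv p $ 2)^b *
         (cw p ^ j * ((1 - cw p) ^ d * cw p ^ (k - d - j))))"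
    proof (intro sum.cong refl)
      fix a b d assume "d \<in> {d. int d \<le> n}"
      \<comment> \<open>This keeps the exponent \<open>k - d - j\<close> from being
        truncated.\<close>
      then have "d + j \<le> k" using assms(2) by simp
      from pyr_inv_power[OF p(2) this]
      show "c a b d * (pyr_inv p $ 1)^a * (pyr_inv p $ 2)^b * ((pyr_inv p $ 3)^d / (1 + pyr_inv p $ 3)^k) =
        c a b d * (pyr_inv p $ 1)^a * (pyr_inv p $ 2)^b * (cw p ^ j * ((1 - cw p) ^ d * cw p ^ (k - d - j)))"
        by (rule arg_cong)
    qed
    also have "\<dots> = cw p ^ j * Q (chart p)"
      by (simp add: Q_def pyr_inv_def sum_distrib_left mult_ac)
    finally show "q (pyr_inv p) = cw p ^ j * Q (chart p)" .
  qed
qed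

section \<open>The inclusions\<close>

lemma grad_on_pyramid:
  assumes "grad_on below_apex f g" "\<And>p. p \<in> pyramid \<Longrightarrow> p $ 3 < 1 \<Longrightarrow> u p = f p"
  shows "grad_on (interior pyramid) u g"
  by (rule grad_on_cong[OF grad_on_subset[OF assms(1)] open_interior])
     (use interior_pyramid assms(2) in force)+

lemma U3_subset_L2: "U3 k \<subseteq> L2_space pyramid"
proof
  fix u assume "u \<in> U3 k"
  then have u: "pullback3 pyr_map u \<in> Qrat (k + 3) (int k - 1) (int k - 1) (int k - 1)"
    by (simp add: U3_def U3_inf_def)
  obtain Q where Q: "continuously_differentiable Q"
    "\<And>p. p \<in> pyramid \<Longrightarrow> p $ 3 < 1 \<Longrightarrow> pullback3 pyr_map u (pyr_inv p) = cw p ^ 4 * Q (chart p)"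
    \<comment> \<open>The gap \<open>(k + 3) - (k - 1) = 4\<close> matches the Jacobian determinant
      \<open>w^4\<close>.\<close>
    using Qrat_pyr_inv[OF u, of 4] by auto
  show "u \<in> L2_space pyramid"
    by (rule L2_space_pyramidI[OF continuously_differentiable_imp_continuous[OF Q(1)]])
       (simp add: pullback3_pyr_inv Q(2))
qed

lemma U0_subset_H1: "U0 k \<subseteq> H1_space pyramid"
proof
  fix u assume "u \<in> U0 k"
  then obtain q a where q: "q \<in> Qrat k (int k) (int k) (int k - 1)"
    and u: "\<And>p. p \<in> inf_pyramid \<Longrightarrow> pullback0 pyr_map u p = q p + a * ((p$3)^k / (1 + p$3)^k)"
    unfolding U0_def U0_inf_def by blast
  obtain Q where Q: "continuously_differentiable Q"
    "\<And>p. p \<in> pyramid \<Longrightarrow> p $ 3 < 1 \<Longrightarrow> q (pyr_inv p) = cw p ^ 1 * Q (chart p)"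
    using Qrat_pyr_inv[OF q, of 1] by auto
  obtain G where G: "continuous_on UNIV G"
    "grad_on below_apex (\<lambda>p. cw p * Q (chart p)) (\<lambda>p. G (chart p))"
    using grad_on_height_mult_chart[OF Q(1)] .
  have eq: "u p = cw p * Q (chart p) + a * (p$3) ^ k" if "p \<in> pyramid" "p $ 3 < 1" for p
    using pullback0_pyr_inv[OF that(2), of u] u[OF pyr_inv_in_inf_pyramid[OF that]] Q(2)[OF that]
      pyr_inv_power[OF that(2), of k 0 k] by simp
  \<comment> \<open>\<open>?g\<close> keeps the shape that the gradient rules produce, zero summand
    included; \<open>?H\<close> is the same field with \<zeta> written as
    \<open>1 - w\<close>.\<close>
  let ?g = "\<lambda>p::real^3. G (chart p) + (a *\<^sub>R ((real k * p $ 3 ^ (k - 1)) *\<^sub>R axis 3 1) + p $ 3 ^ k *\<^sub>R 0)"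
  let ?H = "\<lambda>v. G v + (a *\<^sub>R ((real k * (1 - snd (snd v)) ^ (k - 1)) *\<^sub>R axis 3 1) + (1 - snd (snd v)) ^ k *\<^sub>R 0)"
  show "u \<in> H1_space pyramid"
  proof (rule H1_spaceI)
    show "u \<in> L2_space pyramid"
      by (rule L2_space_pyramidI[of "\<lambda>v. snd (snd v) * Q v + a * (1 - snd (snd v)) ^ k"])
         (auto simp: eq intro!: continuous_intros continuously_differentiable_imp_continuous[OF Q(1)])
    show "?g \<in> L2_space pyramid"
      by (rule L2_space_pyramidI[of ?H]) (auto intro!: continuous_intros G(1))
    show "grad_on (interior pyramid) u ?g"
      by (rule grad_on_pyramid[OF grad_on_add[OF G(2) grad_on_mult[OF grad_on_const grad_on_power[OF grad_on_component]]]])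
         (simp add: eq)
  qed
qed

text \<open>The scalar prefactors of the extra terms of 1-forms and 2-forms for
  \<open>k = Suc m\<close>.\<close>

lemma pyr_inv_weight:
  assumes "p $ 3 < 1"
  shows "(pyr_inv p $ 3) ^ m / (1 + pyr_inv p $ 3) ^ (m + 2) = (cw p)\<^sup>2 * p $ 3 ^ m"
    "pyr_inv p $ 3 = p $ 3 / cw p" 
    "(pyr_inv p $ 3) ^ m / (1 + pyr_inv p $ 3) ^ (m + 3) = (cw p)^3 * p $ 3 ^ m"
    "1 + pyr_inv p $ 3 = 1 / cw p"
  using pyr_inv_power[OF assms, of m 2 "m + 2"] pyr_inv_power[OF assms, of m 3 "m + 3"] assms
  by (simp_all add: pyr_inv_def field_simps)

text \<open>The field is \<open>\<zeta>\<^sup>m\<^sup>+\<^sup>1 \<nabla>(w r) - \<zeta>\<^sup>m w r e\<^sub>3\<close>, so no second derivatives of \<open>r(x, y)\<close>, which are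
  unbounded, occur in its curl.\<close>

lemma grad_on_curl_term:
  assumes r: "grad_on UNIV r (\<lambda>v. (r1 v, r2 v, 0))"
    and r1: "grad_on UNIV r1 (\<lambda>v. (r11 v, r12 v, 0))"
    and r2: "grad_on UNIV r2 (\<lambda>v. (r12 v, r22 v, 0))"
  obtains G1 G2 G3 where
    "grad_on below_apex (\<lambda>p. p$3 ^ Suc m * r1 (chart p)) G1"
    "grad_on below_apex (\<lambda>p. p$3 ^ Suc m * r2 (chart p)) G2"
    "grad_on below_apex (\<lambda>p. p$3 ^ m * (p$3 * (cx p * r1 (chart p) + cy p * r2 (chart p)) - r (chart p))) G3"
    "\<And>p. p $ 3 < 1 \<Longrightarrow> G3 p $ 2 - G2 p $ 3 = - (real (Suc (Suc m)) * p$3 ^ m * r2 (chart p))"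
    "\<And>p. p $ 3 < 1 \<Longrightarrow> G1 p $ 3 - G3 p $ 1 = real (Suc (Suc m)) * p$3 ^ m * r1 (chart p)"
    "\<And>p. p $ 3 < 1 \<Longrightarrow> G2 p $ 1 - G1 p $ 2 = 0"
proof -
  note z = grad_on_power[OF grad_on_component[of below_apex "3 :: 3"]]
  note g = grad_on_comp_chart[OF r] and g1 = grad_on_comp_chart[OF r1] and g2 = grad_on_comp_chart[OF r2]
  note G1 = grad_on_mult[OF z[of "Suc m"] g1] and G2 = grad_on_mult[OF z[of "Suc m"] g2]
  note G3 = grad_on_mult[OF z[of m] grad_on_diff[OF grad_on_mult[OF grad_on_component[of _ "3 :: 3"]
      grad_on_add[OF grad_on_mult[OF grad_on_cx g1] grad_on_mult[OF grad_on_cy g2]]] g]]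
  \<comment> \<open>This turns the remaining difference of two terms of order \<open>1 / w\<close>
    into a bounded one, since \<zeta> - 1 is \<open>- w\<close>.\<close>
  have i: "p $ 3 * inverse (1 - p $ 3) - inverse (1 - p $ 3) = -1" if "p $ 3 < 1" for p :: "real^3"
    using right_inverse[of "1 - p $ 3"] that by (simp add: left_diff_distrib)
  show thesis
  proof (rule that[OF G1 G2 G3], goal_cases)
    case (1 p)
    have "p $ 3 ^ m * r2 (chart p) * (p $ 3 * inverse (1 - p $ 3) - inverse (1 - p $ 3)) = - (p $ 3 ^ m * r2 (chart p))"
      using i[OF 1] by simp
    then show ?case by (simp add: axis_def divide_inverse algebra_simps)
  next
    case (2 p)
    have "p $ 3 ^ m * r1 (chart p) * (p $ 3 * inverse (1 - p $ 3) - inverse (1 - p $ 3)) = - (p $ 3 ^ m * r1 (chart p))"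
      using i[OF 2] by simp
    then show ?case by (simp add: axis_def divide_inverse algebra_simps)
  next
    case (3 p)
    \<comment> \<open>Both derivatives contain the same mixed derivative \<open>r12\<close>.\<close>
    show ?case by (simp add: axis_def)
  qed
qed

text \<open>The second derivatives cancel between the horizontal and vertical parts. The factor 2
  balances the first-order terms: \<open>2 * s2 / w\<close> meets one \<open>s2 / w\<close> from
  differentiating \<open>x\<close> and one from differentiating \<open>y\<close>. For
  \<open>m = 0\<close> the right-hand side is zero whatever the truncated exponent.\<close>

lemma grad_on_div_term_s:
  assumes s: "grad_on UNIV s (\<lambda>v. (s1 v, s2 v, 0))"
    and s2: "grad_on UNIV s2 (\<lambda>v. (s12 v, s22 v, 0))"
  obtains G1 G2 G3 where
    "grad_on below_apex (\<lambda>p. - (p$3 ^ m * (cx p * s2 (chart p)))) G1"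
    "grad_on below_apex (\<lambda>p. p$3 ^ m * (2 * s (chart p) - cy p * s2 (chart p))) G2"
    "grad_on below_apex (\<lambda>p. p$3 ^ m * s2 (chart p)) G3"
    "\<And>p. p $ 3 < 1 \<Longrightarrow> G1 p $ 1 + G2 p $ 2 + G3 p $ 3 = real m * p$3 ^ (m - 1) * s2 (chart p)"
proof -
  note z = grad_on_power[OF grad_on_component[of below_apex "3 :: 3"], of m]
  note g = grad_on_comp_chart[OF s] and g2 = grad_on_comp_chart[OF s2]
  note G1 = grad_on_minus[OF grad_on_mult[OF z grad_on_mult[OF grad_on_cx g2]]]
  note G2 = grad_on_mult[OF z grad_on_diff[OF grad_on_mult[OF grad_on_const[of _ 2] g] grad_on_mult[OF grad_on_cy g2]]]
  note G3 = grad_on_mult[OF z g2]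
  show thesis
    by (rule that[OF G1 G2 G3]) (simp add: axis_def algebra_simps add_divide_distrib)
qed

text \<open>Mirror image of the previous cancellation under exchange of \<open>x\<close> and
  \<open>y\<close>.\<close>

lemma grad_on_div_term_t:
  assumes t: "grad_on UNIV t (\<lambda>v. (t1 v, t2 v, 0))"
    and t1: "grad_on UNIV t1 (\<lambda>v. (t11 v, t12 v, 0))"
  obtains G1 G2 G3 where
    "grad_on below_apex (\<lambda>p. p$3 ^ m * (2 * t (chart p) - cx p * t1 (chart p))) G1"
    "grad_on below_apex (\<lambda>p. - (p$3 ^ m * (cy p * t1 (chart p)))) G2"
    "grad_on below_apex (\<lambda>p. p$3 ^ m * t1 (chart p)) G3"
    "\<And>p. p $ 3 < 1 \<Longrightarrow> G1 p $ 1 + G2 p $ 2 + G3 p $ 3 = real m * p$3 ^ (m - 1) * t1 (chart p)"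
proof -
  note z = grad_on_power[OF grad_on_component[of below_apex "3 :: 3"], of m]
  note g = grad_on_comp_chart[OF t] and g1 = grad_on_comp_chart[OF t1]
  note G1 = grad_on_mult[OF z grad_on_diff[OF grad_on_mult[OF grad_on_const[of _ 2] g] grad_on_mult[OF grad_on_cx g1]]]
  note G2 = grad_on_minus[OF grad_on_mult[OF z grad_on_mult[OF grad_on_cy g1]]]
  note G3 = grad_on_mult[OF z g1]
  show thesis
    by (rule that[OF G1 G2 G3]) (simp add: axis_def algebra_simps add_divide_distrib)
qed

section \<open>The inclusions for 1-forms and 2-forms\<close>

lemma U1_subset_Hcurl: "U1 (Suc m) \<subseteq> Hcurl_space pyramid"
proof
  fix u assume "u \<in> U1 (Suc m)"
  then obtain q1 q2 q3 r where q: "q1 \<in> Qrat (Suc m + 1) (int (Suc m) - 1) (int (Suc m)) (int (Suc m) - 1)"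
      "q2 \<in> Qrat (Suc m + 1) (int (Suc m)) (int (Suc m) - 1) (int (Suc m) - 1)"
      "q3 \<in> Qrat (Suc m + 1) (int (Suc m)) (int (Suc m)) (int (Suc m) - 2)"
    and r: "r \<in> Qpoly2 (int (Suc m)) (int (Suc m))"
    and u: "\<And>p. p \<in> inf_pyramid \<Longrightarrow> pullback1 pyr_map u p = vector [q1 p, q2 p, q3 p] +
        ((p$3)^m / (1 + p$3)^(m + 2)) *\<^sub>R vector [deriv (\<lambda>t. r t (p$2)) (p$1) * p$3,
           deriv (\<lambda>t. r (p$1) t) (p$2) * p$3, - r (p$1) (p$2)]"
    unfolding U1_def U1_inf_def Let_def by auto
  \<comment> \<open>The gaps \<open>(k + 1) - (k - 1) = 2\<close> and
    \<open>(k + 1) - (k - 2) = 3\<close> exceed by one what \<open>pullback1_pyr_inv\<close>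
    consumes.\<close>
  obtain Q1 where Q1: "continuously_differentiable Q1"
    "\<And>p. p \<in> pyramid \<Longrightarrow> p $ 3 < 1 \<Longrightarrow> q1 (pyr_inv p) = cw p ^ 2 * Q1 (chart p)"
    using Qrat_pyr_inv[OF q(1), of 2] by auto
  obtain Q2 where Q2: "continuously_differentiable Q2"
    "\<And>p. p \<in> pyramid \<Longrightarrow> p $ 3 < 1 \<Longrightarrow> q2 (pyr_inv p) = cw p ^ 2 * Q2 (chart p)"
    using Qrat_pyr_inv[OF q(2), of 2] by auto
  obtain Q3 where Q3: "continuously_differentiable Q3"
    "\<And>p. p \<in> pyramid \<Longrightarrow> p $ 3 < 1 \<Longrightarrow> q3 (pyr_inv p) = cw p ^ 3 * Q3 (chart p)"
    using Qrat_pyr_inv[OF q(3), of 3] by auto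
  define R where "R = (\<lambda>(x, y, w :: real). r x y)"
  obtain r1 r2 r11 r12 r22 where R: "grad_on UNIV R (\<lambda>v. (r1 v, r2 v, 0))"
    "grad_on UNIV r1 (\<lambda>v. (r11 v, r12 v, 0))" "grad_on UNIV r2 (\<lambda>v. (r12 v, r22 v, 0))"
    by (rule grad_on_Qpoly2[OF r, folded R_def])
  \<comment> \<open>The inverse of the transposed Jacobian mixes all three components into the
    third.\<close>
  let ?Q3 = "\<lambda>v. fst v * Q1 v + fst (snd v) * Q2 v + Q3 v"
  have Q3': "continuously_differentiable ?Q3"
    by (intro cd_intros Q1 Q2 Q3)
  obtain H1 where H1: "continuous_on UNIV H1" "grad_on below_apex (\<lambda>p. cw p * Q1 (chart p)) (\<lambda>p. H1 (chart p))"
    using grad_on_height_mult_chart[OF Q1(1)] .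
  obtain H2 where H2: "continuous_on UNIV H2" "grad_on below_apex (\<lambda>p. cw p * Q2 (chart p)) (\<lambda>p. H2 (chart p))"
    using grad_on_height_mult_chart[OF Q2(1)] .
  obtain H3 where H3: "continuous_on UNIV H3" "grad_on below_apex (\<lambda>p. cw p * ?Q3 (chart p)) (\<lambda>p. H3 (chart p))"
    using grad_on_height_mult_chart[OF Q3'] .
  obtain G1 G2 G3 where G:
    "grad_on below_apex (\<lambda>p. p$3 ^ Suc m * r1 (chart p)) G1"
    "grad_on below_apex (\<lambda>p. p$3 ^ Suc m * r2 (chart p)) G2"
    "grad_on below_apex (\<lambda>p. p$3 ^ m * (p$3 * (cx p * r1 (chart p) + cy p * r2 (chart p)) - R (chart p))) G3"
    and curl:
    "\<And>p. p $ 3 < 1 \<Longrightarrow> G3 p $ 2 - G2 p $ 3 = - (real (Suc (Suc m)) * p$3 ^ m * r2 (chart p))"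
    "\<And>p. p $ 3 < 1 \<Longrightarrow> G1 p $ 3 - G3 p $ 1 = real (Suc (Suc m)) * p$3 ^ m * r1 (chart p)"
    "\<And>p. p $ 3 < 1 \<Longrightarrow> G2 p $ 1 - G1 p $ 2 = 0"
    by (rule grad_on_curl_term[OF R, where m = m]) (erule (2) that; blast)
  let ?F = "\<lambda>v. vector [snd (snd v) * Q1 v + (1 - snd (snd v)) ^ Suc m * r1 v,
      snd (snd v) * Q2 v + (1 - snd (snd v)) ^ Suc m * r2 v,
      snd (snd v) * ?Q3 v + (1 - snd (snd v)) ^ m *
        ((1 - snd (snd v)) * (fst v * r1 v + fst (snd v) * r2 v) - R v)] :: real^3"
  \<comment> \<open>The curl in chart coordinates: the \<open>H\<close> parts stem from the
    polynomial terms, the multiples of \<open>real (Suc (Suc m))\<close> from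
    \<open>curl\<close>.\<close>
  let ?C = "\<lambda>v. vector [H3 v $ 2 - H2 v $ 3 - real (Suc (Suc m)) * (1 - snd (snd v)) ^ m * r2 v,
      H1 v $ 3 - H3 v $ 1 + real (Suc (Suc m)) * (1 - snd (snd v)) ^ m * r1 v,
      H2 v $ 1 - H1 v $ 2] :: real^3"
  have eq: "u p = ?F (chart p)" if p: "p \<in> pyramid" "p $ 3 < 1" for p
  proof -
    define w where "w = cw p"
    define x y where "x = cx p" and "y = cy p"
    have c: "chart p = (x, y, w)" by (simp add: chart_def x_def y_def w_def)
    have w: "w \<noteq> 0" and z: "p $ 3 = 1 - w" using p by (auto simp: w_def)
    have D: "deriv (\<lambda>t. r t (cy p)) (cx p) = r1 (chart p)" "deriv (\<lambda>t. r (cx p) t) (cy p) = r2 (chart p)"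
      "r (cx p) (cy p) = R (chart p)"
      using deriv_eq_grad[OF R(1)[unfolded R_def]] by (auto simp: chart_def R_def)
    define e where "e = pullback1 pyr_map u (pyr_inv p)"
    have i: "pyr_inv p $ 1 = cx p" "pyr_inv p $ 2 = cy p" by (simp_all add: pyr_inv_def)
    \<comment> \<open>The prefactor of the extra term gives \<open>w^2\<close>; in the first two
      components \<open>z = \<zeta> / w\<close> takes one factor back.\<close>
    have e: "e $ 1 = w\<^sup>2 * Q1 (chart p) + w * p $ 3 ^ Suc m * r1 (chart p)"
       "e $ 2 = w\<^sup>2 * Q2 (chart p) + w * p $ 3 ^ Suc m * r2 (chart p)"
       "e $ 3 = w ^ 3 * Q3 (chart p) - w\<^sup>2 * p $ 3 ^ m * R (chart p)"
      unfolding e_def u[OF pyr_inv_in_inf_pyramid[OF p]] pyr_inv_weight(1)[OF p(2)] i D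
      using w by (simp_all add: Q1 Q2 Q3 p pyr_inv_weight(2)[OF p(2)] w_def[symmetric] power2_eq_square)
    have *: "e $ 1 / w = w * Q1 (chart p) + p $ 3 ^ Suc m * r1 (chart p)"
      "e $ 2 / w = w * Q2 (chart p) + p $ 3 ^ Suc m * r2 (chart p)"
      "e $ 3 / w / w = w * Q3 (chart p) - p $ 3 ^ m * R (chart p)"
      unfolding e using w by (simp_all add: field_simps power2_eq_square power3_eq_cube)
    have "u p = vector [e $ 1 / w, e $ 2 / w, cx p * (e $ 1 / w) + cy p * (e $ 2 / w) + e $ 3 / w / w]"
      using pullback1_pyr_inv[OF p(2) e_def] by (simp add: w_def add_divide_distrib)
    also have "\<dots> = vector [e $ 1 / w, e $ 2 / w, x * (e $ 1 / w) + y * (e $ 2 / w) + e $ 3 / w / w]"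
      by (simp add: x_def y_def)
    also have "\<dots> = ?F (chart p)"
      unfolding * c z by (simp add: algebra_simps)
    finally show ?thesis .
  qed
  have cont: "continuous_on UNIV Q1" "continuous_on UNIV Q2" "continuous_on UNIV Q3"
    "continuous_on UNIV R" "continuous_on UNIV r1" "continuous_on UNIV r2"
    using Q1 Q2 Q3 R by (auto intro: continuously_differentiable_imp_continuous grad_on_imp_continuous)
  show "u \<in> Hcurl_space pyramid"
  proof (rule Hcurl_spaceI)
    show "u \<in> L2_space pyramid"
      by (rule L2_space_pyramidI[where F = ?F, OF _ eq]) (intro continuous_on_vector3 continuous_intros cont)
    show "(\<lambda>p. ?C (chart p)) \<in> L2_space pyramid"
      by (rule L2_space_pyramidI[where F = ?C, OF _ refl]) (intro continuous_on_vector3 continuous_intros cont H1 H2 H3)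
    let ?G = "\<lambda>i::3. \<lambda>p. if i = 1 then H1 (chart p) + G1 p else if i = 2 then H2 (chart p) + G2 p else H3 (chart p) + G3 p"
    have g1: "grad_on (interior pyramid) (\<lambda>p. u p $ 1) (?G 1)"
      using grad_on_pyramid[OF grad_on_add[OF H1(2) G(1)], of "\<lambda>p. u p $ 1"] by (simp add: eq)
    have g2: "grad_on (interior pyramid) (\<lambda>p. u p $ 2) (?G 2)"
      using grad_on_pyramid[OF grad_on_add[OF H2(2) G(2)], of "\<lambda>p. u p $ 2"] by (simp add: eq)
    have g3: "grad_on (interior pyramid) (\<lambda>p. u p $ 3) (?G 3)"
      using grad_on_pyramid[OF grad_on_add[OF H3(2) G(3)], of "\<lambda>p. u p $ 3"] by (simp add: eq)
    show "grad_on (interior pyramid) (\<lambda>p. u p $ i) (?G i)" for i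
    proof -
      consider "i = 1" | "i = 2" | "i = 3" using exhaust_3 by blast
      then show ?thesis by cases (hypsubst, rule g1 g2 g3)+
    qed
    show "?C (chart p) = vector [?G 3 p $ 2 - ?G 2 p $ 3, ?G 1 p $ 3 - ?G 3 p $ 1, ?G 2 p $ 1 - ?G 1 p $ 2]"
      if "p \<in> interior pyramid" for p
    proof -
      have "p $ 3 < 1" using that interior_pyramid by blast
      from curl[OF this] show ?thesis by (simp add: vec_eq_iff forall_3)
    qed
  qed
qed

lemma U2_subset_Hdiv: "U2 (Suc m) \<subseteq> Hdiv_space pyramid"
proof
  fix u assume "u \<in> U2 (Suc m)"
  then obtain q1 q2 q3 s t where q: "q1 \<in> Qrat (Suc m + 2) (int (Suc m)) (int (Suc m) - 1) (int (Suc m) - 2)"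
      "q2 \<in> Qrat (Suc m + 2) (int (Suc m) - 1) (int (Suc m)) (int (Suc m) - 2)"
      "q3 \<in> Qrat (Suc m + 2) (int (Suc m) - 1) (int (Suc m) - 1) (int (Suc m) - 1)"
    and s: "s \<in> Qpoly2 (int (Suc m) - 1) (int (Suc m))" and t: "t \<in> Qpoly2 (int (Suc m)) (int (Suc m) - 1)"
    and u: "\<And>p. p \<in> inf_pyramid \<Longrightarrow> pullback2 pyr_map u p = vector [q1 p, q2 p, q3 p]
        + ((p$3)^m / (1 + p$3)^(m + 3)) *\<^sub>R
            vector [0, 2 * s (p$1) (p$2), deriv (\<lambda>v. s (p$1) v) (p$2) * (1 + p$3)]
        + ((p$3)^m / (1 + p$3)^(m + 3)) *\<^sub>R
            vector [2 * t (p$1) (p$2), 0, deriv (\<lambda>v. t v (p$2)) (p$1) * (1 + p$3)]"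
    unfolding U2_def U2_inf_def Let_def by (auto simp: eval_nat_numeral)
  \<comment> \<open>The gaps are now 4, 4 and 3, again one more than
    \<open>pullback2_pyr_inv\<close> consumes.\<close>
  obtain Q1 where Q1: "continuously_differentiable Q1"
    "\<And>p. p \<in> pyramid \<Longrightarrow> p $ 3 < 1 \<Longrightarrow> q1 (pyr_inv p) = cw p ^ 4 * Q1 (chart p)"
    using Qrat_pyr_inv[OF q(1), of 4] by auto
  obtain Q2 where Q2: "continuously_differentiable Q2"
    "\<And>p. p \<in> pyramid \<Longrightarrow> p $ 3 < 1 \<Longrightarrow> q2 (pyr_inv p) = cw p ^ 4 * Q2 (chart p)"
    using Qrat_pyr_inv[OF q(2), of 4] by auto
  obtain Q3 where Q3: "continuously_differentiable Q3"
    "\<And>p. p \<in> pyramid \<Longrightarrow> p $ 3 < 1 \<Longrightarrow> q3 (pyr_inv p) = cw p ^ 3 * Q3 (chart p)"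
    using Qrat_pyr_inv[OF q(3), of 3] by auto
  define S where "S = (\<lambda>(x, y, w :: real). s x y)"
  obtain s1 s2 s11 s12 s22 where S: "grad_on UNIV S (\<lambda>v. (s1 v, s2 v, 0))"
    "grad_on UNIV s1 (\<lambda>v. (s11 v, s12 v, 0))" "grad_on UNIV s2 (\<lambda>v. (s12 v, s22 v, 0))"
    by (rule grad_on_Qpoly2[OF s, folded S_def])
  define T where "T = (\<lambda>(x, y, w :: real). t x y)"
  obtain t1 t2 t11 t12 t22 where T: "grad_on UNIV T (\<lambda>v. (t1 v, t2 v, 0))"
    "grad_on UNIV t1 (\<lambda>v. (t11 v, t12 v, 0))" "grad_on UNIV t2 (\<lambda>v. (t12 v, t22 v, 0))"
    by (rule grad_on_Qpoly2[OF t, folded T_def])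
  \<comment> \<open>The subtracted terms come from the last column of the Jacobian.\<close>
  let ?Q1 = "\<lambda>v. Q1 v - fst v * Q3 v" and ?Q2 = "\<lambda>v. Q2 v - fst (snd v) * Q3 v"
  have Q': "continuously_differentiable ?Q1" "continuously_differentiable ?Q2"
    by (intro cd_intros Q1 Q2 Q3)+
  obtain H1 where H1: "continuous_on UNIV H1" "grad_on below_apex (\<lambda>p. cw p * ?Q1 (chart p)) (\<lambda>p. H1 (chart p))"
    using grad_on_height_mult_chart[OF Q'(1)] .
  obtain H2 where H2: "continuous_on UNIV H2" "grad_on below_apex (\<lambda>p. cw p * ?Q2 (chart p)) (\<lambda>p. H2 (chart p))"
    using grad_on_height_mult_chart[OF Q'(2)] .
  obtain H3 where H3: "continuous_on UNIV H3" "grad_on below_apex (\<lambda>p. cw p * Q3 (chart p)) (\<lambda>p. H3 (chart p))"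
    using grad_on_height_mult_chart[OF Q3(1)] .
  obtain G1 G2 G3 where G:
    "grad_on below_apex (\<lambda>p. - (p$3 ^ m * (cx p * s2 (chart p)))) G1"
    "grad_on below_apex (\<lambda>p. p$3 ^ m * (2 * S (chart p) - cy p * s2 (chart p))) G2"
    "grad_on below_apex (\<lambda>p. p$3 ^ m * s2 (chart p)) G3"
    and Gdiv: "\<And>p. p $ 3 < 1 \<Longrightarrow> G1 p $ 1 + G2 p $ 2 + G3 p $ 3 = real m * p$3 ^ (m - 1) * s2 (chart p)"
    by (rule grad_on_div_term_s[OF S(1,3), where m = m]) (erule (2) that; blast)
  obtain K1 K2 K3 where K:
    "grad_on below_apex (\<lambda>p. p$3 ^ m * (2 * T (chart p) - cx p * t1 (chart p))) K1"
    "grad_on below_apex (\<lambda>p. - (p$3 ^ m * (cy p * t1 (chart p)))) K2"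
    "grad_on below_apex (\<lambda>p. p$3 ^ m * t1 (chart p)) K3"
    and Kdiv: "\<And>p. p $ 3 < 1 \<Longrightarrow> K1 p $ 1 + K2 p $ 2 + K3 p $ 3 = real m * p$3 ^ (m - 1) * t1 (chart p)"
    by (rule grad_on_div_term_t[OF T(1,2), where m = m]) (erule (2) that; blast)
  let ?F = "\<lambda>v. vector
     [snd (snd v) * ?Q1 v + - ((1 - snd (snd v)) ^ m * (fst v * s2 v))
        + (1 - snd (snd v)) ^ m * (2 * T v - fst v * t1 v),
      snd (snd v) * ?Q2 v + (1 - snd (snd v)) ^ m * (2 * S v - fst (snd v) * s2 v)
        + - ((1 - snd (snd v)) ^ m * (fst (snd v) * t1 v)),
      snd (snd v) * Q3 v + (1 - snd (snd v)) ^ m * s2 v + (1 - snd (snd v)) ^ m * t1 v] :: real^3"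
  \<comment> \<open>Sum of the bounded divergence of the polynomial part and the two right-hand
    sides of \<open>Gdiv\<close> and \<open>Kdiv\<close>.\<close>
  let ?d = "\<lambda>v. H1 v $ 1 + H2 v $ 2 + H3 v $ 3 + real m * (1 - snd (snd v)) ^ (m - 1) * (s2 v + t1 v)"
  have eq: "u p = ?F (chart p)" if p: "p \<in> pyramid" "p $ 3 < 1" for p
  proof -
    define w where "w = cw p"
    define x y where "x = cx p" and "y = cy p"
    have c: "chart p = (x, y, w)" by (simp add: chart_def x_def y_def w_def)
    have w: "w \<noteq> 0" and z: "p $ 3 = 1 - w" using p by (auto simp: w_def)
    have D: "deriv (\<lambda>v. s (cx p) v) (cy p) = s2 (chart p)" "deriv (\<lambda>v. t v (cy p)) (cx p) = t1 (chart p)"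
      "s (cx p) (cy p) = S (chart p)" "t (cx p) (cy p) = T (chart p)"
      using deriv_eq_grad[OF S(1)[unfolded S_def]] deriv_eq_grad[OF T(1)[unfolded T_def]]
      by (auto simp: chart_def S_def T_def)
    define e where "e = pullback2 pyr_map u (pyr_inv p)"
    have i: "pyr_inv p $ 1 = cx p" "pyr_inv p $ 2 = cy p" by (simp_all add: pyr_inv_def)
    \<comment> \<open>The third component has only \<open>w^2\<close> in front because its factor
      \<open>1 + z = 1 / w\<close> uses up one power of the prefactor \<open>w^3\<close>.\<close>
    have e: "e $ 1 = w ^ 3 * (w * Q1 (chart p) + p $ 3 ^ m * (2 * T (chart p)))"
       "e $ 2 = w ^ 3 * (w * Q2 (chart p) + p $ 3 ^ m * (2 * S (chart p)))"
       "e $ 3 = w ^ 2 * (w * Q3 (chart p) + p $ 3 ^ m * (s2 (chart p) + t1 (chart p)))"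
      unfolding e_def u[OF pyr_inv_in_inf_pyramid[OF p]] pyr_inv_weight(3)[OF p(2)] i D
      using w
      by (simp_all add: Q1 Q2 Q3 p pyr_inv_weight(4)[OF p(2)] w_def[symmetric] power2_eq_square
          power3_eq_cube power4_eq_xxxx algebra_simps)
    \<comment> \<open>\<open>a\<close> is the third component of \<open>u p\<close>; it enters the
      other two multiplied by \<open>- x\<close> and \<open>- y\<close>.\<close>
    define a where "a = w * Q3 (chart p) + p $ 3 ^ m * (s2 (chart p) + t1 (chart p))"
    have "e $ 1 - x * w * e $ 3 = w ^ 3 * (w * Q1 (chart p) + p $ 3 ^ m * (2 * T (chart p)) - x * a)"
      "e $ 2 - y * w * e $ 3 = w ^ 3 * (w * Q2 (chart p) + p $ 3 ^ m * (2 * S (chart p)) - y * a)"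
      "e $ 3 = w ^ 2 * a"
      unfolding e a_def[symmetric]
      by (simp_all add: right_diff_distrib power2_eq_square power3_eq_cube)
    then have *: "(e $ 1 - x * w * e $ 3) / w ^ 3 = w * Q1 (chart p) + p $ 3 ^ m * (2 * T (chart p)) - x * a"
      "(e $ 2 - y * w * e $ 3) / w ^ 3 = w * Q2 (chart p) + p $ 3 ^ m * (2 * S (chart p)) - y * a"
      "e $ 3 / w ^ 2 = a"
      using w by simp_all
    have "u p = vector [(e $ 1 - x * w * e $ 3) / w ^ 3, (e $ 2 - y * w * e $ 3) / w ^ 3, e $ 3 / w ^ 2]"
      using pullback2_pyr_inv[OF p(2) e_def] by (simp add: w_def x_def y_def)
    also have "\<dots> = ?F (chart p)"
      unfolding * a_def c z by (simp add: algebra_simps)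
    finally show ?thesis .
  qed
  have cont: "continuous_on UNIV Q1" "continuous_on UNIV Q2" "continuous_on UNIV Q3"
    "continuous_on UNIV S" "continuous_on UNIV s2" "continuous_on UNIV T" "continuous_on UNIV t1"
    using Q1 Q2 Q3 S T by (auto intro: continuously_differentiable_imp_continuous grad_on_imp_continuous)
  show "u \<in> Hdiv_space pyramid"
  proof (rule Hdiv_spaceI)
    show "u \<in> L2_space pyramid"
      by (rule L2_space_pyramidI[where F = ?F, OF _ eq]) (intro continuous_on_vector3 continuous_intros cont)
    show "(\<lambda>p. ?d (chart p)) \<in> L2_space pyramid"
      by (rule L2_space_pyramidI[where F = ?d, OF _ refl]) (intro continuous_intros cont H1 H2 H3)
    let ?G = "\<lambda>i::3. \<lambda>p. if i = 1 then H1 (chart p) + G1 p + K1 p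
      else if i = 2 then H2 (chart p) + G2 p + K2 p else H3 (chart p) + G3 p + K3 p"
    have g1: "grad_on (interior pyramid) (\<lambda>p. u p $ 1) (?G 1)"
      using grad_on_pyramid[OF grad_on_add[OF grad_on_add[OF H1(2) G(1)] K(1)], of "\<lambda>p. u p $ 1"] by (simp add: eq)
    have g2: "grad_on (interior pyramid) (\<lambda>p. u p $ 2) (?G 2)"
      using grad_on_pyramid[OF grad_on_add[OF grad_on_add[OF H2(2) G(2)] K(2)], of "\<lambda>p. u p $ 2"] by (simp add: eq)
    have g3: "grad_on (interior pyramid) (\<lambda>p. u p $ 3) (?G 3)"
      using grad_on_pyramid[OF grad_on_add[OF grad_on_add[OF H3(2) G(3)] K(3)], of "\<lambda>p. u p $ 3"] by (simp add: eq)
    show "grad_on (interior pyramid) (\<lambda>p. u p $ i) (?G i)" for i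
    proof -
      consider "i = 1" | "i = 2" | "i = 3" using exhaust_3 by blast
      then show ?thesis by cases (hypsubst, rule g1 g2 g3)+
    qed
    show "?d (chart p) = (\<Sum>i\<in>UNIV. ?G i p $ i)" if "p \<in> interior pyramid" for p
    proof -
      have "p $ 3 < 1" using that interior_pyramid by blast
      from Gdiv[OF this] Kdiv[OF this] show ?thesis by (simp add: sum_3 algebra_simps)
    qed
  qed
qed

theorem theorem4p1:
  fixes k :: nat
  assumes "k \<ge> 1"
  shows "U0 k \<subseteq> H1_space pyramid \<and> U1 k \<subseteq> Hcurl_space pyramid \<and>
         U2 k \<subseteq> Hdiv_space pyramid \<and> U3 k \<subseteq> L2_space pyramid"
proof -
  \<comment> \<open>Writing \<open>k\<close> as a successor turns the natural subtraction
    \<open>k - 1\<close> in the exponents of the extra terms into \<open>m\<close>.\<close>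
  obtain m where "k = Suc m" using assms by (cases k) auto
  then show ?thesis
    using U0_subset_H1 U1_subset_Hcurl U2_subset_Hdiv U3_subset_L2 by simp
qed

end
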